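(* Let $\varphi,\psi$ be holomorphic functions from the open unit disk $\mathbb{D}$ to $\mathbb{C}$ with $\varphi(0)=0$, $\varphi'(0)\neq0$, $\psi(0)\neq0$, and let $n\ge 2$. There exists a transformation $\overrightarrow{\Phi}_n:\mathbb{D}^{n-1}\to X^{(2)}_n(\mathcal{B}_{\varphi,\psi})$ of the form $\overrightarrow{\Phi}_n(\mathbf{z})=\overrightarrow{K}_n\circ\overrightarrow{F}_{n-1}(\mathbf{z})$, where $\overrightarrow{K}_n$ is a polynomial transformation of $\mathbb{C}^{n-1}$ and $\overrightarrow{F}_{n-1}$ is the (non-analytic) polynomial transformation of $\mathbb{C}^{n-1}$ defined in the context, such that: (i) $\overrightarrow{\Phi}_n$ is a continuous mapping of $\overline{\mathbb{D}^{n-1}}$ onto $X^{(2)}_{n}(\mathcal{B}_{\varphi,\psi})$. (ii) If, in addition, $\psi'(0)\neq 0$, then $\overrightarrow{K}_n$ is an automorphism of $\mathbb{C}^{n-1}$. In this case, $\overrightarrow{\Phi}_n(\mathbb{D}^{n-1})=\operatorname{Int} X^{(2)}_{n}(\mathcal{B}_{\varphi,\psi})$, $\overrightarrow{\Phi}_n(\partial(\mathbb{D}^{n-1}))=\partial X^{(2)}_{n}(\mathcal{B}_{\varphi,\psi})$, and $\overrightarrow{\Phi}_n$ is a real analytic diffeomorphism on $\mathbb{D}^{n-1}$ but is not injective on the boundary of $\mathbb{D}^{n-1}$.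
   Context: $\Omega$ is the set of holomorphic self-mappings $\omega$ of $\mathbb{D}$ with $\omega(0)=0$. $\mathcal{A}_{\varphi,\psi}$ is the class of functions $F$ holomorphic in $\mathbb{D}$ for which there is $\omega\in\Omega$ with $F(z)=\varphi(z)\psi(\omega(z))$ for all $z\in\mathbb{D}$. Each such $F$ satisfies $F(0)=0$, $F'(0)=\varphi'(0)\psi(0)\ne0$, hence is invertible near zero, and the local inverses $F^{-1}$ (with $F^{-1}(0)=0$) are all holomorphic in a common disk around zero depending only on $\varphi,\psi$; $\mathcal{B}_{\varphi,\psi}:=\{F^{-1}:F\in\mathcal{A}_{\varphi,\psi}\}$. For a class $\mathcal{F}$ of functions holomorphic around zero and $n\ge2$, $$X^{(2)}_n(\mathcal{F})=\Big\{(a_2,\ldots,a_n):\ \exists f\in\mathcal{F},\ f(z)=\sum_{k=0}^{n}a_kz^k+o(z^n)\Big\}\subset\mathbb{C}^{n-1}.$$ $\operatorname{Int}$ and $\partial$ denote the topological interior and boundary in $\mathbb{C}^{n-1}$. The transformation $\overrightarrow{F}_{N}=(F_1,\ldots,F_N)$ of $\mathbb{C}^{N}$ has coordinates $F_m(z_1,\ldots,z_m)$ defined recursively by $F_1(z_1)=z_1$ and, for $m=2,\ldots,N$, $$F_m(z_1,\ldots,z_m)=(1-|z_1|^2)F_{m-1}(z_2,\ldots,z_m)-\overline{z_1}\sum_{k=2}^{m-1}F_{m-k}(z_2,\ldots,z_{m-k+1})F_k(z_1,\ldots,z_k).$$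
   Formalization: Non-injectivity on the boundary of the polydisc is asserted only for n ≥ 3; for n = 2 it is false, since F_1 is the identity and K_2 is an automorphism of ℂ, so Φ_2 is injective on the unit circle. All other claims hold for every n ≥ 2. *)

theory Defs
  imports "HOL-Complex_Analysis.Complex_Analysis" "HOL-Library.Landau_Symbols"
begin

text \<open>
  A point \<open>(z\<^sub>1, \<dots>, z\<^sub>N)\<close> of \<open>\<complex>\<^sup>N\<close> is an extensional function on the index set \<open>{1..N}\<close>;
  interior, closure and frontier are taken in the topology below, whose \<^const>\<open>topspace\<close>
  is the set of all these points.
\<close>

definition cspace :: "nat \<Rightarrow> (nat \<Rightarrow> complex) topology" where
  "cspace N = product_topology (\<lambda>_. euclidean) {1..N}"

definition polydisc :: "nat \<Rightarrow> (nat \<Rightarrow> complex) set" where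
  "polydisc N = ({1..N} \<rightarrow>\<^sub>E ball 0 1)"

definition multi_indices :: "nat \<Rightarrow> (nat \<Rightarrow> nat) set" where
  "multi_indices N = ({1..N} \<rightarrow>\<^sub>E UNIV)"


definition polynomial_fun :: "nat \<Rightarrow> ((nat \<Rightarrow> complex) \<Rightarrow> complex) \<Rightarrow> bool" where
  "polynomial_fun N p \<longleftrightarrow>
     (\<exists>M c. finite M \<and> M \<subseteq> multi_indices N \<and>
        (\<forall>z \<in> topspace (cspace N). p z = (\<Sum>\<alpha>\<in>M. c \<alpha> * (\<Prod>i=1..N. z i ^ \<alpha> i))))"

definition polynomial_transformation ::
    "nat \<Rightarrow> ((nat \<Rightarrow> complex) \<Rightarrow> (nat \<Rightarrow> complex)) \<Rightarrow> bool" where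
  "polynomial_transformation N K \<longleftrightarrow>
     K \<in> topspace (cspace N) \<rightarrow> topspace (cspace N) \<and>
     (\<forall>j\<in>{1..N}. polynomial_fun N (\<lambda>z. K z j))"

text \<open>An automorphism in the category of polynomial maps: the inverse is polynomial as well.\<close>

definition polynomial_automorphism ::
    "nat \<Rightarrow> ((nat \<Rightarrow> complex) \<Rightarrow> (nat \<Rightarrow> complex)) \<Rightarrow> bool" where
  "polynomial_automorphism N K \<longleftrightarrow>
     polynomial_transformation N K \<and>
     (\<exists>L. polynomial_transformation N L \<and>
        (\<forall>z \<in> topspace (cspace N). L (K z) = z \<and> K (L z) = z))"


text \<open>
  Real analyticity refers to the \<open>2N\<close> real coordinates \<open>Re z\<^sub>i\<close>, \<open>Im z\<^sub>i\<close>. The coefficients are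
  complex because the function is; this amounts to real analyticity of its real and
  imaginary parts. The set \<open>U\<close> is meant to be open.
\<close>

definition real_analytic_fun_on ::
    "nat \<Rightarrow> (nat \<Rightarrow> complex) set \<Rightarrow> ((nat \<Rightarrow> complex) \<Rightarrow> complex) \<Rightarrow> bool" where
  "real_analytic_fun_on N U f \<longleftrightarrow>
     (\<forall>a\<in>U. \<exists>r>0. \<exists>c. \<forall>z\<in>U. (\<forall>i\<in>{1..N}. norm (z i - a i) < r) \<longrightarrow>
        ((\<lambda>(\<alpha>, \<beta>). c \<alpha> \<beta> *
            (\<Prod>i=1..N. of_real (Re (z i - a i)) ^ \<alpha> i * of_real (Im (z i - a i)) ^ \<beta> i))
          has_sum f z) (multi_indices N \<times> multi_indices N))"

definition real_analytic_map_on ::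
    "nat \<Rightarrow> (nat \<Rightarrow> complex) set \<Rightarrow> ((nat \<Rightarrow> complex) \<Rightarrow> (nat \<Rightarrow> complex)) \<Rightarrow> bool" where
  "real_analytic_map_on N U f \<longleftrightarrow> (\<forall>j\<in>{1..N}. real_analytic_fun_on N U (\<lambda>z. f z j))"

definition real_analytic_diffeomorphism ::
    "nat \<Rightarrow> (nat \<Rightarrow> complex) set \<Rightarrow> (nat \<Rightarrow> complex) set \<Rightarrow>
     ((nat \<Rightarrow> complex) \<Rightarrow> (nat \<Rightarrow> complex)) \<Rightarrow> bool" where
  "real_analytic_diffeomorphism N U V f \<longleftrightarrow>
     openin (cspace N) U \<and> openin (cspace N) V \<and> bij_betw f U V \<and>
     real_analytic_map_on N U f \<and> real_analytic_map_on N V (inv_into U f)"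


text \<open>
  \<open>schur_fun m z\<close> is \<open>F\<^sub>m(z\<^sub>1, \<dots>, z\<^sub>m)\<close>; only the entries \<open>z 1, \<dots>, z m\<close> matter, and
  \<open>\<lambda>i. z (Suc i)\<close> is the shifted tuple \<open>(z\<^sub>2, z\<^sub>3, \<dots>)\<close>. The value at \<open>m = 0\<close> is a dummy.
\<close>

function schur_fun :: "nat \<Rightarrow> (nat \<Rightarrow> complex) \<Rightarrow> complex" where
  "schur_fun m z =
     (if m = 0 then 0
      else if m = 1 then z 1
      else (1 - of_real ((norm (z 1))\<^sup>2)) * schur_fun (m - 1) (\<lambda>i. z (Suc i))
           - cnj (z 1) * (\<Sum>k\<in>{2..m-1}. schur_fun (m - k) (\<lambda>i. z (Suc i)) * schur_fun k z))"
  by pat_completeness auto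
termination by (relation "measures [fst]") auto

declare schur_fun.simps [simp del]

definition schur_transformation :: "nat \<Rightarrow> (nat \<Rightarrow> complex) \<Rightarrow> (nat \<Rightarrow> complex)" where
  "schur_transformation N z = (\<lambda>m\<in>{1..N}. schur_fun m z)"


definition Omega :: "(complex \<Rightarrow> complex) set" where
  "Omega = {\<omega>. \<omega> holomorphic_on ball 0 1 \<and> \<omega> ` ball 0 1 \<subseteq> ball 0 1 \<and> \<omega> 0 = 0}"

definition A_class :: "(complex \<Rightarrow> complex) \<Rightarrow> (complex \<Rightarrow> complex) \<Rightarrow> (complex \<Rightarrow> complex) set" where
  "A_class \<phi> \<psi> = {F. F holomorphic_on ball 0 1 \<and>
                     (\<exists>\<omega>\<in>Omega. \<forall>z\<in>ball 0 1. F z = \<phi> z * \<psi> (\<omega> z))}"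

text \<open>
  The members of the next class stand for germs at \<open>0\<close>: any function that is a holomorphic
  local inverse of \<open>F\<close> on some disk around \<open>0\<close> is admitted, with arbitrary values elsewhere.
  Since \<open>F\<close> matters only on the unit disk, the inverse must take its values there.
\<close>

definition B_class :: "(complex \<Rightarrow> complex) \<Rightarrow> (complex \<Rightarrow> complex) \<Rightarrow> (complex \<Rightarrow> complex) set" where
  "B_class \<phi> \<psi> = {g. \<exists>F\<in>A_class \<phi> \<psi>. \<exists>r>0.
                     g holomorphic_on ball 0 r \<and> g 0 = 0 \<and>
                     (\<forall>w\<in>ball 0 r. g w \<in> ball 0 1 \<and> F (g w) = w)}"

text \<open>The tuple \<open>(a\<^sub>2, \<dots>, a\<^sub>n)\<close> is indexed by \<open>{1..n-1}\<close>, with \<open>a\<^sub>j\<^sub>+\<^sub>1\<close> at position \<open>j\<close>.\<close>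

definition X2 :: "nat \<Rightarrow> (complex \<Rightarrow> complex) set \<Rightarrow> (nat \<Rightarrow> complex) set" where
  "X2 n \<F> = {(\<lambda>j\<in>{1..n-1}. a (Suc j)) | a.
               \<exists>f\<in>\<F>. (\<lambda>z. f z - (\<Sum>k=0..n. a k * z ^ k)) \<in> o[at 0](\<lambda>z. z ^ n)}"

end

theory Submission imports Defs begin

text \<open>
  Put \<open>N = n - 1\<close>. For \<open>\<omega> \<in> \<Omega>\<close> let \<open>c\<^sub>1, \<dots>, c\<^sub>N\<close> be its first coefficients. The problem separates
  into describing which tuples \<open>c\<close> occur and describing how the coefficients of \<open>F\<inverse>\<close> depend on \<open>c\<close>.

  The second question is formal. If \<open>P\<close>, \<open>Q\<close>, \<open>W\<close> are the expansions of \<open>\<phi>\<close>, \<open>\<psi>\<close>, \<open>\<omega>\<close>, then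
  \<open>F\<inverse>\<close> has as its expansion the compositional inverse of \<open>P \<cdot> (Q \<circ> W)\<close>. Reverting a series only
  divides by its linear coefficient, which here is the constant \<open>P\<^sub>1 Q\<^sub>0\<close>, so the coefficients of
  orders \<open>2, \<dots>, n\<close> are polynomials in \<open>c\<close>: this is the map \<open>K\<close> (\<open>inverse_coeffs\<close>), and
  \<open>X2_B_class_eq\<close> says that the coefficient set is the image under \<open>K\<close> of all possible \<open>c\<close>.
  If \<open>Q\<^sub>1 \<noteq> 0\<close>, every step can be undone modulo high powers by operations of the same kind: revert
  again, divide by \<open>P\<close>, compose with the inverse series of \<open>Q - Q\<^sub>0\<close>. Hence \<open>K\<close> is a polynomial
  automorphism (\<open>inverse_coeffs_automorphism\<close>), in particular a homeomorphism, and everything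
  in the second half of the theorem can be checked before \<open>K\<close> is applied.

  The first question is answered by Schur's algorithm. Unless \<open>\<omega>\<close> is a rotation, the Schwarz lemma
  gives \<open>|c\<^sub>1| < 1\<close> and a function \<open>\<nu> \<in> \<Omega>\<close> with \<open>\<omega>(w) (1 + cnj c\<^sub>1 \<nu>(w)) = w (c\<^sub>1 + \<nu>(w))\<close>; iterating
  produces parameters \<open>z\<^sub>1, z\<^sub>2, \<dots>\<close> in the closed disc, and comparing coefficients in this
  identity gives exactly the recursion that defines the transformation of the theorem. So
  the tuples \<open>c\<close> fill the image of the closed polydisc (\<open>coefficient_body_eq\<close>).

  As long as the parameters are not unimodular, the recursion can be solved for the next
  parameter by means of a rational expression in \<open>c\<close> and \<open>cnj c\<close> whose denominators are the numbers
  \<open>1 - |z\<^sub>i|\<^sup>2\<close>. On the open polydisc this gives an explicit real analytic inverse and shows that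
  the image is open. On the boundary it still determines the parameters up to and including the first
  unimodular one, say \<open>z\<^sub>i\<close>: replacing \<open>z\<^sub>i\<close> by \<open>(1 + t) z\<^sub>i\<close> moves the image out of the set
  of coefficient tuples for every \<open>t > 0\<close>, so that boundary points are mapped to boundary points
  (\<open>interior_coefficient_body\<close>). What comes after a unimodular parameter has no influence on the image,
  whence the failure of injectivity.
\<close>

unbundle no vec_syntax

section \<open>Polynomial functions on complex tuples\<close>

lemma topspace_cspace: "topspace (cspace N) = {1..N} \<rightarrow>\<^sub>E UNIV"
  by (simp add: cspace_def)

text \<open>
  Sums and products of polynomials arise as finite sums of monomials with repetitions; collecting
  equal exponents brings them into the form that the definition asks for.
\<close>

lemma polynomial_fun_regroup:
  fixes I :: "'i set"
  assumes "finite I" "\<And>i. i \<in> I \<Longrightarrow> mi i \<in> multi_indices N"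
    and p: "\<And>z. z \<in> topspace (cspace N) \<Longrightarrow> p z = (\<Sum>i\<in>I. d i * (\<Prod>j=1..N. z j ^ mi i j))"
  shows "polynomial_fun N p"
  unfolding polynomial_fun_def
proof (intro exI conjI ballI)
  show "finite (mi ` I)" "mi ` I \<subseteq> multi_indices N" using assms(1,2) by auto
  fix z assume z: "z \<in> topspace (cspace N)"
  have "p z = (\<Sum>\<alpha>\<in>mi ` I. \<Sum>i\<in>{i\<in>I. mi i = \<alpha>}. d i * (\<Prod>j=1..N. z j ^ mi i j))"
    unfolding p[OF z] by (rule sum.image_gen[OF assms(1)])
  also have "\<dots> = (\<Sum>\<alpha>\<in>mi ` I. (\<Sum>i\<in>{i\<in>I. mi i = \<alpha>}. d i) * (\<Prod>j=1..N. z j ^ \<alpha> j))"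
    unfolding sum_distrib_right by (intro sum.cong) auto
  finally show "p z = (\<Sum>\<alpha>\<in>mi ` I. (\<Sum>i\<in>{i\<in>I. mi i = \<alpha>}. d i) * (\<Prod>j=1..N. z j ^ \<alpha> j))" .
qed

lemma polynomial_fun_const: "polynomial_fun N (\<lambda>_. k)"
  by (rule polynomial_fun_regroup[of "{()}" "\<lambda>_. \<lambda>i\<in>{1..N}. 0" _ _ "\<lambda>_. k"])
    (auto simp: multi_indices_def)

lemma polynomial_fun_coordinate:
  assumes "j \<in> {1..N}"
  shows "polynomial_fun N (\<lambda>z. z j)"
proof (rule polynomial_fun_regroup[of "{()}" "\<lambda>_. \<lambda>i\<in>{1..N}. if i = j then 1 else 0" _ _ "\<lambda>_. 1"])
  fix z :: "nat \<Rightarrow> complex"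
  have "(\<Prod>i=1..N. z i ^ (\<lambda>i\<in>{1..N}. if i = j then 1 else 0) i) = (\<Prod>i=1..N. if i = j then z i else 1)"
    by (rule prod.cong) auto
  then show "z j = (\<Sum>u\<in>{()}. 1 * (\<Prod>i=1..N. z i ^ (\<lambda>i\<in>{1..N}. if i = j then 1 else 0) i))"
    using assms by simp
qed (auto simp: multi_indices_def)

lemma polynomial_fun_add:
  assumes "polynomial_fun N p" "polynomial_fun N q"
  shows "polynomial_fun N (\<lambda>z. p z + q z)"
proof -
  from assms(1) obtain M c where M: "finite M" "M \<subseteq> multi_indices N"
    "\<And>z. z \<in> topspace (cspace N) \<Longrightarrow> p z = (\<Sum>\<alpha>\<in>M. c \<alpha> * (\<Prod>i=1..N. z i ^ \<alpha> i))"
    unfolding polynomial_fun_def by blast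
  from assms(2) obtain M' c' where M': "finite M'" "M' \<subseteq> multi_indices N"
    "\<And>z. z \<in> topspace (cspace N) \<Longrightarrow> q z = (\<Sum>\<alpha>\<in>M'. c' \<alpha> * (\<Prod>i=1..N. z i ^ \<alpha> i))"
    unfolding polynomial_fun_def by blast
  show ?thesis
    by (rule polynomial_fun_regroup[of "M <+> M'" "case_sum id id" _ _ "case_sum c c'"])
      (use M M' in \<open>auto simp: sum.Plus\<close>)
qed

lemma polynomial_fun_mult:
  assumes "polynomial_fun N p" "polynomial_fun N q"
  shows "polynomial_fun N (\<lambda>z. p z * q z)"
proof -
  from assms(1) obtain M c where M: "finite M" "M \<subseteq> multi_indices N"
    "\<And>z. z \<in> topspace (cspace N) \<Longrightarrow> p z = (\<Sum>\<alpha>\<in>M. c \<alpha> * (\<Prod>i=1..N. z i ^ \<alpha> i))"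
    unfolding polynomial_fun_def by blast
  from assms(2) obtain M' c' where M': "finite M'" "M' \<subseteq> multi_indices N"
    "\<And>z. z \<in> topspace (cspace N) \<Longrightarrow> q z = (\<Sum>\<alpha>\<in>M'. c' \<alpha> * (\<Prod>i=1..N. z i ^ \<alpha> i))"
    unfolding polynomial_fun_def by blast
  have mon: "(\<Prod>i=1..N. z i ^ (\<lambda>i\<in>{1..N}. \<alpha> i + \<beta> i) i) = (\<Prod>i=1..N. z i ^ \<alpha> i) * (\<Prod>i=1..N. z i ^ \<beta> i)"
    for z :: "nat \<Rightarrow> complex" and \<alpha> \<beta> :: "nat \<Rightarrow> nat"
    unfolding prod.distrib[symmetric] by (rule prod.cong) (auto simp: power_add)
  show ?thesis
  proof (rule polynomial_fun_regroup[of "M \<times> M'" "\<lambda>(\<alpha>, \<beta>). \<lambda>i\<in>{1..N}. \<alpha> i + \<beta> i" _ _ "\<lambda>(\<alpha>, \<beta>). c \<alpha> * c' \<beta>"])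
    show "(\<lambda>(\<alpha>, \<beta>). \<lambda>i\<in>{1..N}. \<alpha> i + \<beta> i) x \<in> multi_indices N" for x :: "(nat \<Rightarrow> nat) \<times> (nat \<Rightarrow> nat)"
      by (cases x) (auto simp: multi_indices_def)
    fix z assume z: "z \<in> topspace (cspace N)"
    have "p z * q z = (\<Sum>\<alpha>\<in>M. \<Sum>\<beta>\<in>M'. (c \<alpha> * (\<Prod>i=1..N. z i ^ \<alpha> i)) * (c' \<beta> * (\<Prod>i=1..N. z i ^ \<beta> i)))"
      unfolding M(3)[OF z] M'(3)[OF z] by (rule sum_product)
    also have "\<dots> = (\<Sum>x\<in>M \<times> M'. (case x of (\<alpha>, \<beta>) \<Rightarrow> c \<alpha> * c' \<beta>) *
        (\<Prod>j = 1..N. z j ^ (case x of (\<alpha>, \<beta>) \<Rightarrow> \<lambda>i\<in>{1..N}. \<alpha> i + \<beta> i) j))"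
      unfolding sum.cartesian_product
      by (rule sum.cong) (auto simp only: case_prod_conv mon mult_ac)
    finally show "p z * q z = (\<Sum>x\<in>M \<times> M'. (case x of (\<alpha>, \<beta>) \<Rightarrow> c \<alpha> * c' \<beta>) *
        (\<Prod>j = 1..N. z j ^ (case x of (\<alpha>, \<beta>) \<Rightarrow> \<lambda>i\<in>{1..N}. \<alpha> i + \<beta> i) j))" .
  qed (use M M' in auto)
qed

lemma polynomial_fun_diff:
  assumes "polynomial_fun N p" "polynomial_fun N q"
  shows "polynomial_fun N (\<lambda>z. p z - q z)"
  using polynomial_fun_add[OF assms(1) polynomial_fun_mult[OF polynomial_fun_const[of N "-1"] assms(2)]] by simp

lemma polynomial_fun_sum:
  "(\<And>i. i \<in> I \<Longrightarrow> polynomial_fun N (f i)) \<Longrightarrow> polynomial_fun N (\<lambda>z. \<Sum>i\<in>I. f i z)"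
  by (induction I rule: infinite_finite_induct) (auto intro: polynomial_fun_const polynomial_fun_add)

section \<open>Algebras of functions closed under inverses\<close>

text \<open>
  The inverse of the Schur transformation is a rational expression in the coordinates and
  their conjugates. Both its continuity and its real analyticity follow from the closure
  properties collected here, so each argument about such expressions is made once and then used with
  \<open>P\<close> meaning ``continuous'' and \<open>P\<close> meaning ``locally given by a convergent expansion''.
\<close>

locale inverse_closed_algebra =
  fixes U :: "'a set" and P :: "('a \<Rightarrow> complex) \<Rightarrow> bool"
  assumes const: "P (\<lambda>_. k)"
    and add: "P f \<Longrightarrow> P g \<Longrightarrow> P (\<lambda>x. f x + g x)"
    and mult: "P f \<Longrightarrow> P g \<Longrightarrow> P (\<lambda>x. f x * g x)"
    and conj: "P f \<Longrightarrow> P (\<lambda>x. cnj (f x))"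
    and inverse: "P f \<Longrightarrow> (\<And>x. x \<in> U \<Longrightarrow> f x \<noteq> 0) \<Longrightarrow> P (\<lambda>x. inverse (f x))"
    and cong: "P f \<Longrightarrow> (\<And>x. x \<in> U \<Longrightarrow> f x = g x) \<Longrightarrow> P g"
begin

lemma diff: "P f \<Longrightarrow> P g \<Longrightarrow> P (\<lambda>x. f x - g x)"
  using add[of f "\<lambda>x. - 1 * g x"] mult[of "\<lambda>_. - 1" g] const[of "- 1"] by simp

lemma sum: "(\<And>i. i \<in> I \<Longrightarrow> P (f i)) \<Longrightarrow> P (\<lambda>x. \<Sum>i\<in>I. f i x)"
  by (induction I rule: infinite_finite_induct) (auto intro: const add)

lemma prod: "(\<And>i. i \<in> I \<Longrightarrow> P (f i)) \<Longrightarrow> P (\<lambda>x. \<Prod>i\<in>I. f i x)"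
  by (induction I rule: infinite_finite_induct) (auto intro: const mult)

lemma power: "P f \<Longrightarrow> P (\<lambda>x. f x ^ k)"
  by (induction k) (auto intro: const mult)

lemma norm_squared: "P f \<Longrightarrow> P (\<lambda>x. of_real ((norm (f x))\<^sup>2))"
  unfolding complex_norm_square by (intro mult conj)

lemma polynomial:
  assumes p: "polynomial_fun N p" and z: "\<And>i. i \<in> {1..N} \<Longrightarrow> P (\<lambda>x. z x i)"
    and top: "\<And>x. x \<in> U \<Longrightarrow> z x \<in> topspace (cspace N)"
  shows "P (\<lambda>x. p (z x))"
proof -
  from p obtain M c where
    M: "\<And>z. z \<in> topspace (cspace N) \<Longrightarrow> p z = (\<Sum>\<alpha>\<in>M. c \<alpha> * (\<Prod>i=1..N. z i ^ \<alpha> i))"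
    unfolding polynomial_fun_def by blast
  have "P (\<lambda>x. \<Sum>\<alpha>\<in>M. c \<alpha> * (\<Prod>i=1..N. z x i ^ \<alpha> i))"
    by (intro sum mult const prod power z)
  then show ?thesis by (rule cong) (use M top in auto)
qed

end

lemma continuous_map_mult_complex:
  fixes f g :: "'a \<Rightarrow> complex"
  shows "continuous_map X euclidean f \<Longrightarrow> continuous_map X euclidean g \<Longrightarrow> continuous_map X euclidean (\<lambda>x. f x * g x)"
  by (simp add: continuous_map_atin tendsto_mult)

lemma inverse_closed_algebra_continuous_map:
  "inverse_closed_algebra (topspace X) (continuous_map X euclidean)"
proof
  show "continuous_map X euclidean (\<lambda>x. inverse (f x))"
    if "continuous_map X euclidean f" "\<And>x. x \<in> topspace X \<Longrightarrow> f x \<noteq> 0" for f :: "'a \<Rightarrow> complex"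
    using that by (simp add: continuous_map_atin tendsto_inverse)
  show "continuous_map X euclidean (\<lambda>x. cnj (f x))"
    if "continuous_map X euclidean f" for f :: "'a \<Rightarrow> complex"
    using that by (simp add: continuous_map_atin tendsto_cnj)
  show "continuous_map X euclidean g" if "continuous_map X euclidean f" "\<And>x. x \<in> topspace X \<Longrightarrow> f x = g x"
    for f g :: "'a \<Rightarrow> complex"
    using continuous_map_eq that by blast
qed (auto intro: continuous_map_add continuous_map_mult_complex)

section \<open>Continuity of polynomial maps\<close>

lemma continuous_map_coordinate: "j \<in> {1..N} \<Longrightarrow> continuous_map (cspace N) euclidean (\<lambda>z. z j)"
  unfolding cspace_def by (rule continuous_map_product_projection)

lemma polynomial_fun_continuous:
  assumes "polynomial_fun N p"
  shows "continuous_map (cspace N) euclidean p"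
  using inverse_closed_algebra.polynomial[OF inverse_closed_algebra_continuous_map assms,
      where z = "\<lambda>x. x" and X1 = "cspace N"] continuous_map_coordinate by auto

lemma continuous_map_into_cspace:
  assumes "f \<in> topspace X \<rightarrow> topspace (cspace N)" "\<And>j. j \<in> {1..N} \<Longrightarrow> continuous_map X euclidean (\<lambda>z. f z j)"
  shows "continuous_map X (cspace N) f"
  using assms unfolding cspace_def continuous_map_componentwise by (auto simp: PiE_def)

lemma polynomial_transformation_continuous:
  assumes "polynomial_transformation N K"
  shows "continuous_map (cspace N) (cspace N) K"
  using assms unfolding polynomial_transformation_def
  by (intro continuous_map_into_cspace polynomial_fun_continuous) auto

lemma polynomial_automorphism_homeomorphic:
  assumes "polynomial_automorphism N K"
  shows "homeomorphic_map (cspace N) (cspace N) K"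
proof -
  from assms obtain L where "polynomial_transformation N K" "polynomial_transformation N L"
    "\<And>z. z \<in> topspace (cspace N) \<Longrightarrow> L (K z) = z \<and> K (L z) = z"
    unfolding polynomial_automorphism_def by blast
  then have "homeomorphic_maps (cspace N) (cspace N) K L"
    unfolding homeomorphic_maps_def by (simp add: polynomial_transformation_continuous)
  then show ?thesis using homeomorphic_map_maps by blast
qed

section \<open>Power series depending polynomially on parameters\<close>

definition poly_fps :: "nat \<Rightarrow> ((nat \<Rightarrow> complex) \<Rightarrow> complex fps) \<Rightarrow> bool" where
  "poly_fps N P \<longleftrightarrow> (\<forall>m. polynomial_fun N (\<lambda>z. P z $ m))"

lemma poly_fps_const: "poly_fps N (\<lambda>_. f)"
  by (simp add: poly_fps_def polynomial_fun_const)

lemma poly_fps_diff: "poly_fps N P \<Longrightarrow> poly_fps N Q \<Longrightarrow> poly_fps N (\<lambda>z. P z - Q z)"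
  by (simp add: poly_fps_def polynomial_fun_diff)

lemma poly_fps_mult: "poly_fps N P \<Longrightarrow> poly_fps N Q \<Longrightarrow> poly_fps N (\<lambda>z. P z * Q z)"
  unfolding poly_fps_def fps_mult_nth by (intro allI polynomial_fun_sum polynomial_fun_mult) auto

lemma poly_fps_power: "poly_fps N P \<Longrightarrow> poly_fps N (\<lambda>z. P z ^ k)"
  by (induction k) (auto intro: poly_fps_const poly_fps_mult)

lemma poly_fps_compose: "poly_fps N P \<Longrightarrow> poly_fps N Q \<Longrightarrow> poly_fps N (\<lambda>z. P z oo Q z)"
  using poly_fps_power[of N Q] unfolding poly_fps_def fps_compose_nth
  by (intro allI polynomial_fun_sum polynomial_fun_mult) auto

lemma poly_fps_shift: "poly_fps N P \<Longrightarrow> poly_fps N (\<lambda>z. fps_shift k (P z))"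
  by (simp add: poly_fps_def)

text \<open>
  The only divisor in the recursion for the compositional inverse is a power of the linear
  coefficient; this is why that coefficient must not vary with the parameters.
\<close>

lemma poly_fps_inv:
  assumes P: "poly_fps N P" and k: "\<And>z. P z $ 1 = k"
  shows "poly_fps N (\<lambda>z. fps_inv (P z))"
proof -
  have "polynomial_fun N (\<lambda>z. compinv (P z) m)" for m
  proof (induction m rule: less_induct)
    case (less m)
    show ?case
    proof (cases m)
      case 0 then show ?thesis by (simp add: polynomial_fun_const)
    next
      case (Suc n)
      have "polynomial_fun N (\<lambda>z. (fps_X $ Suc n - (\<Sum>i=0..n. compinv (P z) i * (P z ^ i) $ Suc n)) * (1 / k ^ Suc n))"
        using poly_fps_power[OF P] less Suc unfolding poly_fps_def
        by (intro polynomial_fun_diff polynomial_fun_mult polynomial_fun_const polynomial_fun_sum) auto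
      then show ?thesis unfolding Suc compinv.simps k by simp
    qed
  qed
  then show ?thesis by (simp add: poly_fps_def fps_inv_def)
qed

section \<open>Power series modulo high powers\<close>

definition fps_agree :: "nat \<Rightarrow> 'a::zero fps \<Rightarrow> 'a fps \<Rightarrow> bool" where
  "fps_agree m f g \<longleftrightarrow> (\<forall>i\<le>m. f $ i = g $ i)"

lemma fps_agree_refl [simp]: "fps_agree m f f"
  by (simp add: fps_agree_def)

lemma fps_agree_diff: "fps_agree m f f' \<Longrightarrow> fps_agree m g g' \<Longrightarrow> fps_agree m (f - g) (f' - g')"
  for f :: "'a::comm_ring_1 fps"
  by (simp add: fps_agree_def)

lemma fps_agree_mult: "fps_agree m f f' \<Longrightarrow> fps_agree m g g' \<Longrightarrow> fps_agree m (f * g) (f' * g')"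
  for f :: "'a::comm_ring_1 fps"
  by (auto simp: fps_agree_def fps_mult_nth intro!: sum.cong)

lemma fps_agree_power: "fps_agree m f g \<Longrightarrow> fps_agree m (f ^ k) (g ^ k)"
  for f :: "'a::comm_ring_1 fps"
  by (induction k) (auto intro: fps_agree_mult)

lemma fps_agree_compose: "fps_agree m f g \<Longrightarrow> fps_agree m (h oo f) (h oo g)"
  for f :: "'a::comm_ring_1 fps"
  using fps_agree_power[of m f g] by (auto simp: fps_agree_def fps_compose_nth intro!: sum.cong)

lemma fps_agree_shift: "fps_agree (m + k) f g \<Longrightarrow> fps_agree m (fps_shift k f) (fps_shift k g)"
  by (simp add: fps_agree_def)

text \<open>
  A factor without constant term raises the order of agreement. This is the reason why \<open>N\<close>
  coefficients of \<open>\<omega>\<close> determine the coefficients of \<open>F\<inverse>\<close> up to order \<open>N + 1\<close>.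
\<close>

lemma fps_agree_mult_Suc:
  fixes h :: "'a::comm_ring_1 fps"
  assumes "h $ 0 = 0" "fps_agree m f g"
  shows "fps_agree (Suc m) (h * f) (h * g)"
  unfolding fps_agree_def fps_mult_nth
proof (intro allI impI sum.cong refl)
  fix i j assume "i \<le> Suc m" "j \<in> {0..i}"
  then show "h $ j * f $ (i - j) = h $ j * g $ (i - j)"
    using assms by (cases j) (auto simp: fps_agree_def)
qed

lemma fps_agree_inv:
  fixes f g :: "'a::field fps"
  assumes "fps_agree m f g"
  shows "fps_agree m (fps_inv f) (fps_inv g)"
proof -
  have "compinv f k = compinv g k" if "k \<le> m" for k
    using that
  proof (induction k rule: less_induct)
    case (less k)
    show ?case
    proof (cases k)
      case (Suc n)
      have "f $ 1 = g $ 1" "(f ^ i) $ Suc n = (g ^ i) $ Suc n" for i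
        using assms fps_agree_power[OF assms, of i] Suc less.prems unfolding fps_agree_def by auto
      moreover have "compinv f i = compinv g i" if "i \<le> n" for i using less that Suc by auto
      ultimately show ?thesis unfolding Suc compinv.simps by simp
    qed simp
  qed
  then show ?thesis by (simp add: fps_agree_def fps_inv_def)
qed

section \<open>From coefficients of the Schwarz function to coefficients of the inverse\<close>

definition tuple_fps :: "nat \<Rightarrow> (nat \<Rightarrow> complex) \<Rightarrow> complex fps" where
  "tuple_fps N z = Abs_fps (\<lambda>k. if k \<in> {1..N} then z k else 0)"

text \<open>
  With \<open>P\<close> and \<open>Q\<close> the expansions of \<open>\<phi>\<close> and \<open>\<psi>\<close>, this is the polynomial map \<open>K\<close>.
\<close>

definition inverse_coeffs :: "complex fps \<Rightarrow> complex fps \<Rightarrow> nat \<Rightarrow> (nat \<Rightarrow> complex) \<Rightarrow> (nat \<Rightarrow> complex)" where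
  "inverse_coeffs P Q N z = (\<lambda>j\<in>{1..N}. fps_inv (P * (Q oo tuple_fps N z)) $ Suc j)"

text \<open>
  A candidate for the expansion of \<open>F\<inverse>\<close>: its linear coefficient \<open>\<mu>\<close> is the same for all members
  of the class, and position \<open>j\<close> of the tuple holds the coefficient of order \<open>j + 1\<close>.
\<close>

definition inverse_fps :: "complex \<Rightarrow> nat \<Rightarrow> (nat \<Rightarrow> complex) \<Rightarrow> complex fps" where
  "inverse_fps \<mu> N w = Abs_fps (\<lambda>k. if k = 1 then \<mu> else if k \<in> {2..Suc N} then w (k - 1) else 0)"

text \<open>
  The equation \<open>P \<cdot> (Q \<circ> W) = f\<close>, in which \<open>f\<close> is the compositional inverse of a candidate for the
  expansion of \<open>F\<inverse>\<close>, solved for \<open>W\<close>. Since \<open>P\<close> and \<open>f\<close> both vanish at the origin, the quotient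
  \<open>f / P\<close> is formed after cancelling the variable, which keeps every coefficient polynomial.
\<close>

definition recovered_fps :: "complex fps \<Rightarrow> complex fps \<Rightarrow> nat \<Rightarrow> (nat \<Rightarrow> complex) \<Rightarrow> complex fps" where
  "recovered_fps P Q N w = fps_inv (Q - fps_const (Q $ 0)) oo
     (fps_shift 1 (fps_inv (inverse_fps (1 / (P $ 1 * Q $ 0)) N w)) * inverse (fps_shift 1 P) - fps_const (Q $ 0))"

definition recovered_coeffs :: "complex fps \<Rightarrow> complex fps \<Rightarrow> nat \<Rightarrow> (nat \<Rightarrow> complex) \<Rightarrow> (nat \<Rightarrow> complex)" where
  "recovered_coeffs P Q N w = (\<lambda>j\<in>{1..N}. recovered_fps P Q N w $ j)"

lemma poly_fps_tuple: "poly_fps N (tuple_fps N)"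
  unfolding poly_fps_def
proof
  fix m show "polynomial_fun N (\<lambda>z. tuple_fps N z $ m)"
    by (cases "m \<in> {1..N}") (simp_all add: tuple_fps_def polynomial_fun_coordinate polynomial_fun_const del: atLeastAtMost_iff)
qed

lemma poly_fps_inverse_fps: "poly_fps N (inverse_fps \<mu> N)"
  unfolding poly_fps_def
proof
  fix m :: nat
  consider "m = 1" | "m \<noteq> 1" "m \<in> {2..Suc N}" | "m \<noteq> 1" "m \<notin> {2..Suc N}" by blast
  then show "polynomial_fun N (\<lambda>z. inverse_fps \<mu> N z $ m)"
  proof cases
    case 2
    then have "m - 1 \<in> {1..N}" by auto
    then show ?thesis using 2 by (simp add: inverse_fps_def polynomial_fun_coordinate)
  qed (auto simp: inverse_fps_def polynomial_fun_const)
qed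

lemma inverse_coeffs_polynomial:
  assumes "P $ 0 = 0"
  shows "polynomial_transformation N (inverse_coeffs P Q N)"
proof -
  have "poly_fps N (\<lambda>z. fps_inv (P * (Q oo tuple_fps N z)))"
    by (rule poly_fps_inv[where k = "P $ 1 * Q $ 0"])
      (use assms in \<open>auto intro!: poly_fps_mult poly_fps_compose poly_fps_const poly_fps_tuple simp: fps_mult_nth\<close>)
  then show ?thesis unfolding polynomial_transformation_def inverse_coeffs_def topspace_cspace poly_fps_def
    by auto
qed

lemma recovered_coeffs_polynomial:
  "polynomial_transformation N (recovered_coeffs P Q N)"
proof -
  have "poly_fps N (recovered_fps P Q N)" unfolding recovered_fps_def
    by (intro poly_fps_inv[where k = "1 / (P $ 1 * Q $ 0)"] poly_fps_compose poly_fps_mult poly_fps_const poly_fps_shift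
      poly_fps_inverse_fps poly_fps_diff) (auto simp: inverse_fps_def)
  then show ?thesis unfolding polynomial_transformation_def recovered_coeffs_def topspace_cspace poly_fps_def
    by auto
qed

lemma tuple_fps_0 [simp]: "tuple_fps N z $ 0 = 0"
  by (simp add: tuple_fps_def)

lemma fps_eq_X_mult_shift: "P $ 0 = 0 \<Longrightarrow> P = fps_X * fps_shift 1 P" for P :: "complex fps"
  by (simp add: fps_eq_iff)

text \<open>
  The two maps are inverse to each other on full power series, by associativity of composition.
  Passing to tuples truncates the series, and agreement of sufficiently many coefficients is
  carried through each of the operations.
\<close>

lemma recovered_inverse_coeffs:
  assumes P: "P $ 0 = 0" "P $ 1 \<noteq> 0" and Q: "Q $ 0 \<noteq> 0" "Q $ 1 \<noteq> 0" and z: "z \<in> topspace (cspace N)"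
  shows "recovered_coeffs P Q N (inverse_coeffs P Q N z) = z"
proof -
  define W where "W = tuple_fps N z"
  define F where "F = P * (Q oo W)"
  define G where "G = fps_inv F"
  define w where "w = inverse_coeffs P Q N z"
  let ?\<mu> = "1 / (P $ 1 * Q $ 0)"
  let ?Q = "Q - fps_const (Q $ 0)"
  have W0: "W $ 0 = 0" by (simp add: W_def)
  have F: "F $ 0 = 0" "F $ 1 = P $ 1 * Q $ 0" using P by (auto simp: F_def fps_mult_nth)
  then have F1: "F $ 1 \<noteq> 0" using P Q by simp
  have G: "G $ 0 = 0" "G $ 1 = ?\<mu>" using F F1 by (auto simp: G_def fps_inv_def)
  have "fps_agree (Suc N) (inverse_fps ?\<mu> N w) G"
    unfolding fps_agree_def
  proof (intro allI impI)
    fix i assume "i \<le> Suc N"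
    then consider "i = 0" | "i = 1" | "i \<noteq> 1" "i \<in> {2..Suc N}" "i - 1 \<in> {1..N}" "Suc (i - 1) = i" by fastforce
    then show "inverse_fps ?\<mu> N w $ i = G $ i"
    proof cases
      case 3
      then have "inverse_fps ?\<mu> N w $ i = w (i - 1)" by (simp add: inverse_fps_def)
      also have "\<dots> = G $ i"
        using 3 unfolding w_def inverse_coeffs_def G_def F_def W_def by (simp del: atLeastAtMost_iff)
      finally show ?thesis .
    qed (use G in \<open>auto simp: inverse_fps_def\<close>)
  qed
  then have "fps_agree (N + 1) (fps_inv (inverse_fps ?\<mu> N w)) (fps_inv G)"
    by (simp add: fps_agree_inv)
  then have "fps_agree N (fps_shift 1 (fps_inv (inverse_fps ?\<mu> N w))) (fps_shift 1 (fps_inv G))"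
    by (rule fps_agree_shift)
  moreover have "fps_inv G = F" unfolding G_def by (rule fps_inv_idempotent[OF F(1) F1])
  moreover have "fps_shift 1 F = fps_shift 1 P * (Q oo W)"
    unfolding F_def by (subst fps_eq_X_mult_shift[OF P(1)]) (simp add: mult.assoc fps_eq_iff)
  ultimately have "fps_agree N (fps_shift 1 (fps_inv (inverse_fps ?\<mu> N w))) (fps_shift 1 P * (Q oo W))"
    by simp
  then have "fps_agree N (fps_shift 1 (fps_inv (inverse_fps ?\<mu> N w)) * inverse (fps_shift 1 P))
      (fps_shift 1 P * (Q oo W) * inverse (fps_shift 1 P))"
    by (intro fps_agree_mult) auto
  moreover have "fps_shift 1 P * (Q oo W) * inverse (fps_shift 1 P) = Q oo W"
    using inverse_mult_eq_1[of "fps_shift 1 P"] P(2) by (simp add: mult_ac)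
  ultimately have "fps_agree N (fps_shift 1 (fps_inv (inverse_fps ?\<mu> N w)) * inverse (fps_shift 1 P)) (Q oo W)"
    by (simp only:)
  then have "fps_agree N (fps_shift 1 (fps_inv (inverse_fps ?\<mu> N w)) * inverse (fps_shift 1 P) - fps_const (Q $ 0))
      ((Q oo W) - fps_const (Q $ 0))"
    by (intro fps_agree_diff) auto
  then have "fps_agree N (recovered_fps P Q N w) (fps_inv ?Q oo ((Q oo W) - fps_const (Q $ 0)))"
    unfolding recovered_fps_def by (rule fps_agree_compose)
  also have "(Q oo W) - fps_const (Q $ 0) = ?Q oo W"
    by (simp add: fps_compose_sub_distrib)
  also have "fps_inv ?Q oo (?Q oo W) = (fps_inv ?Q oo ?Q) oo W"
    by (rule fps_compose_assoc) (use W0 in auto)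
  also have "\<dots> = W"
    using Q W0 by (subst fps_inv) auto
  finally have "recovered_fps P Q N w $ j = z j" if "j \<in> {1..N}" for j
    using that by (simp add: fps_agree_def W_def tuple_fps_def)
  then show ?thesis
    using z unfolding recovered_coeffs_def w_def[symmetric] topspace_cspace
    by (auto simp: fun_eq_iff PiE_def extensional_def)
qed

lemma inverse_recovered_coeffs:
  assumes P: "P $ 0 = 0" "P $ 1 \<noteq> 0" and Q: "Q $ 0 \<noteq> 0" "Q $ 1 \<noteq> 0" and w: "w \<in> topspace (cspace N)"
  shows "inverse_coeffs P Q N (recovered_coeffs P Q N w) = w"
proof -
  let ?\<mu> = "1 / (P $ 1 * Q $ 0)"
  let ?Q = "Q - fps_const (Q $ 0)"
  define A where "A = inverse_fps ?\<mu> N w"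
  define R where "R = fps_shift 1 (fps_inv A) * inverse (fps_shift 1 P)"
  define H where "H = recovered_fps P Q N w"
  define W where "W = tuple_fps N (recovered_coeffs P Q N w)"
  have A: "A $ 0 = 0" "A $ 1 = ?\<mu>" by (auto simp: A_def inverse_fps_def)
  then have A1: "A $ 1 \<noteq> 0" using P Q by simp
  have fA: "fps_inv A $ 0 = 0" "fps_inv A $ 1 = P $ 1 * Q $ 0" using A by (auto simp: fps_inv_def)
  have R0: "R $ 0 = Q $ 0" using fA P by (simp add: R_def)
  have H: "H = fps_inv ?Q oo (R - fps_const (Q $ 0))"
    by (simp add: H_def recovered_fps_def R_def A_def)
  have H0: "H $ 0 = 0" using Q by (simp add: H fps_inv_def)
  have "?Q oo H = (?Q oo fps_inv ?Q) oo (R - fps_const (Q $ 0))"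
    unfolding H by (rule fps_compose_assoc) (use R0 in \<open>auto simp: fps_inv_def\<close>)
  also have "\<dots> = R - fps_const (Q $ 0)"
    using Q R0 by (subst fps_inv_right) auto
  finally have "Q oo H = R" by (simp add: fps_compose_sub_distrib)
  then have "P * (Q oo H) = fps_X * (fps_shift 1 P * R)"
    by (subst fps_eq_X_mult_shift[OF P(1)]) (simp add: mult.assoc)
  also have "fps_shift 1 P * R = fps_shift 1 (fps_inv A)"
    using inverse_mult_eq_1[of "fps_shift 1 P"] P(2) by (simp add: R_def mult_ac)
  also have "fps_X * fps_shift 1 (fps_inv A) = fps_inv A"
    using fps_eq_X_mult_shift[OF fA(1)] by simp
  finally have PH: "P * (Q oo H) = fps_inv A" .
  have "fps_agree N W H"
    using H0 by (auto simp: fps_agree_def W_def tuple_fps_def recovered_coeffs_def H_def not_less_eq_eq)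
  then have "fps_agree (Suc N) (P * (Q oo W)) (P * (Q oo H))"
    by (intro fps_agree_mult_Suc P fps_agree_compose)
  then have "fps_agree (Suc N) (fps_inv (P * (Q oo W))) (fps_inv (fps_inv A))"
    unfolding PH by (rule fps_agree_inv)
  also have "fps_inv (fps_inv A) = A" by (rule fps_inv_idempotent[OF A(1) A1])
  finally have "fps_inv (P * (Q oo W)) $ Suc j = w j" if "j \<in> {1..N}" for j
    using that by (auto simp: fps_agree_def A_def inverse_fps_def)
  then show ?thesis
    using w unfolding inverse_coeffs_def W_def[symmetric] topspace_cspace
    by (auto simp: fun_eq_iff PiE_def extensional_def)
qed

lemma inverse_coeffs_automorphism:
  assumes "P $ 0 = 0" "P $ 1 \<noteq> 0" "Q $ 0 \<noteq> 0" "Q $ 1 \<noteq> 0"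
  shows "polynomial_automorphism N (inverse_coeffs P Q N)"
  unfolding polynomial_automorphism_def
  using inverse_coeffs_polynomial[OF assms(1)] recovered_coeffs_polynomial[of N P Q]
    recovered_inverse_coeffs[OF assms] inverse_recovered_coeffs[OF assms] by blast

section \<open>The Schur recursion\<close>

lemma schur_fun_1: "schur_fun (Suc 0) z = z 1"
  by (simp add: schur_fun.simps)

lemma schur_fun_rec:
  "m \<ge> 2 \<Longrightarrow> schur_fun m z = (1 - of_real ((norm (z 1))\<^sup>2)) * schur_fun (m - 1) (\<lambda>i. z (Suc i))
           - cnj (z 1) * (\<Sum>k\<in>{2..m-1}. schur_fun (m - k) (\<lambda>i. z (Suc i)) * schur_fun k z)"
  by (subst schur_fun.simps) auto

lemma schur_fun_cong:
  "(\<And>i. i \<in> {1..m} \<Longrightarrow> z i = y i) \<Longrightarrow> schur_fun m z = schur_fun m y"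
proof (induction m arbitrary: z y rule: less_induct)
  case (less m)
  consider "m = 0" | "m = 1" | "m \<ge> 2" by linarith
  then show ?case
  proof cases
    case 3
    have "schur_fun k z = schur_fun k y" if "k \<in> {2..m-1}" for k
      by (rule less.IH) (use that less.prems in auto)
    moreover have "schur_fun (m - k) (\<lambda>i. z (Suc i)) = schur_fun (m - k) (\<lambda>i. y (Suc i))" if "k \<in> {1..m-1}" for k
      by (rule less.IH) (use that less.prems in auto)
    moreover have "z 1 = y 1" using less.prems[of 1] 3 by auto
    ultimately have "(\<Sum>k\<in>{2..m-1}. schur_fun (m - k) (\<lambda>i. z (Suc i)) * schur_fun k z)
        = (\<Sum>k\<in>{2..m-1}. schur_fun (m - k) (\<lambda>i. y (Suc i)) * schur_fun k y)"
      and "schur_fun (m - 1) (\<lambda>i. z (Suc i)) = schur_fun (m - 1) (\<lambda>i. y (Suc i))" and "z 1 = y 1"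
      using 3 by (auto intro!: sum.cong)
    then show ?thesis unfolding schur_fun_rec[OF 3] by simp
  qed (use less.prems[of 1] in \<open>auto simp: schur_fun.simps\<close>)
qed

text \<open>
  The recursion determines the sequence \<open>c\<close> from \<open>z 1\<close> and the sequence \<open>g\<close> of the shifted tuple; this
  is how both Schwarz functions and the inverse algorithm are matched with \<open>schur_fun\<close>.
\<close>

lemma schur_fun_eqI:
  assumes c1: "c 1 = z 1" and g: "\<And>m. 1 \<le> m \<Longrightarrow> m < N \<Longrightarrow> g m = schur_fun m (\<lambda>i. z (Suc i))"
    and c: "\<And>m. 2 \<le> m \<Longrightarrow> m \<le> N \<Longrightarrow>
      c m = (1 - of_real ((norm (z 1))\<^sup>2)) * g (m - 1) - cnj (z 1) * (\<Sum>k\<in>{2..m-1}. g (m - k) * c k)"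
    and m: "m \<in> {1..N}"
  shows "c m = schur_fun m z"
  using m
proof (induction m rule: less_induct)
  case (less m)
  show ?case
  proof (cases "m = 1")
    case True
    then show ?thesis using c1 by (simp add: schur_fun_1)
  next
    case False
    then have m2: "m \<ge> 2" using less.prems by auto
    have "g (m - 1) = schur_fun (m - 1) (\<lambda>i. z (Suc i))" using g[of "m - 1"] m2 less.prems by auto
    moreover have "(\<Sum>k\<in>{2..m-1}. g (m - k) * c k)
        = (\<Sum>k\<in>{2..m-1}. schur_fun (m - k) (\<lambda>i. z (Suc i)) * schur_fun k z)"
      using less by (intro sum.cong refl arg_cong2[of _ _ _ _ "(*)"] g) auto
    ultimately show ?thesis using c[of m] m2 less.prems unfolding schur_fun_rec[OF m2] by simp
  qed
qed

text \<open>
  The factor \<open>1 - |z\<^sub>1|\<^sup>2\<close> vanishes and all other terms contain values of smaller index.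
\<close>

lemma schur_fun_unimodular_head:
  assumes "norm (z 1) = 1" "m \<ge> 2"
  shows "schur_fun m z = 0"
  using assms(2)
proof (induction m rule: less_induct)
  case (less m)
  have "(\<Sum>k\<in>{2..m-1}. schur_fun (m - k) (\<lambda>i. z (Suc i)) * schur_fun k z) = 0"
    using less by (intro sum.neutral) auto
  then show ?case using assms(1) unfolding schur_fun_rec[OF less.prems] by simp
qed

section \<open>The inverse Schur algorithm\<close>

text \<open>
  One step of Schur's algorithm on coefficients: the recursion for \<open>schur_fun (Suc m)\<close> solved for
  the value of the shifted tuple. Repeated \<open>j\<close> times, its first entry is the parameter
  with index \<open>j + 1\<close>. The value at \<open>0\<close> is a dummy.
\<close>

function peel :: "(nat \<Rightarrow> complex) \<Rightarrow> nat \<Rightarrow> complex" where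
  "peel c m = (if m = 0 then 0 else
     (c (Suc m) + cnj (c 1) * (\<Sum>k\<in>{2..m}. peel c (Suc m - k) * c k)) / (1 - of_real ((norm (c 1))\<^sup>2)))"
  by pat_completeness auto
termination by (relation "measures [snd]") auto

declare peel.simps [simp del]

lemma of_real_norm_neq_1: "norm w \<noteq> 1 \<Longrightarrow> 1 - complex_of_real ((norm w)\<^sup>2) \<noteq> 0"
  by (metis abs_norm_cancel eq_iff_diff_eq_0 of_real_eq_1_iff power2_eq_1_iff real_sqrt_abs real_sqrt_one)

lemma peel_schur_fun:
  assumes z: "norm (z 1) \<noteq> 1" and c: "\<And>m. m \<in> {1..Suc M} \<Longrightarrow> c m = schur_fun m z" and m: "m \<in> {1..M}"
  shows "peel c m = schur_fun m (\<lambda>i. z (Suc i))"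
  using m
proof (induction m rule: less_induct)
  case (less m)
  have c1: "c 1 = z 1" using c[of 1] less.prems by (auto simp: schur_fun_1)
  have "(\<Sum>k\<in>{2..m}. peel c (Suc m - k) * c k)
      = (\<Sum>k\<in>{2..m}. schur_fun (Suc m - k) (\<lambda>i. z (Suc i)) * schur_fun k z)"
    using less by (intro sum.cong refl arg_cong2[of _ _ _ _ "(*)"] c less.IH) auto
  moreover have "c (Suc m) = schur_fun (Suc m) z" using c less.prems by auto
  ultimately show ?case
    using less.prems of_real_norm_neq_1[OF z] schur_fun_rec[of "Suc m" z] c1
    by (subst peel.simps) (auto simp: field_simps)
qed

lemma funpow_peel_schur_fun:
  assumes c: "\<And>m. m \<in> {1..N} \<Longrightarrow> c m = schur_fun m z" and "\<And>j. j \<in> {1..k} \<Longrightarrow> norm (z j) \<noteq> 1"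
    and "m \<ge> 1" "m + k \<le> N"
  shows "(peel ^^ k) c m = schur_fun m (\<lambda>i. z (i + k))"
  using assms(2-)
proof (induction k arbitrary: m)
  case 0
  then show ?case using c by simp
next
  case (Suc k)
  have "peel ((peel ^^ k) c) m = schur_fun m (\<lambda>i. (\<lambda>i. z (i + k)) (Suc i))"
    by (rule peel_schur_fun[where M = "N - Suc k"]) (use Suc in auto)
  then show ?case by simp
qed

lemma schur_parameters_recovered:
  assumes "\<And>m. m \<in> {1..N} \<Longrightarrow> c m = schur_fun m z" "i < N" "\<And>j. j \<in> {1..i} \<Longrightarrow> norm (z j) \<noteq> 1"
  shows "(peel ^^ i) c 1 = z (Suc i)"
  using funpow_peel_schur_fun[of N c z i 1] assms by (auto simp: schur_fun_1)

text \<open>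
  Only the parameters before \<open>i\<close> have to be non-unimodular, and only for one of the two tuples, because
  the earlier entries of the other tuple have already been found equal. The parameter \<open>z i\<close> itself
  may be unimodular or even lie outside the disc, which is what makes the lemma
  applicable to perturbed boundary points.
\<close>

lemma schur_fun_injective:
  assumes eq: "\<And>m. m \<in> {1..N} \<Longrightarrow> schur_fun m z = schur_fun m y"
    and "\<And>j. j \<in> {1..<i} \<Longrightarrow> norm (z j) \<noteq> 1" "i \<in> {1..N}"
  shows "z i = y i"
  using assms(2,3)
proof (induction i rule: less_induct)
  case (less i)
  define k where "k = i - 1"
  have k: "i = Suc k" "k < N" using less.prems(2) by (auto simp: k_def)
  have zy: "z j = y j" if "j \<in> {1..k}" for j
    by (rule less.IH) (use that k less.prems in auto)
  have "(peel ^^ k) (\<lambda>m. schur_fun m z) 1 = z (Suc k)"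
    by (rule schur_parameters_recovered[where N = N]) (use k less.prems in auto)
  moreover have "(peel ^^ k) (\<lambda>m. schur_fun m z) 1 = y (Suc k)"
    by (rule schur_parameters_recovered[where N = N]) (use k less.prems eq zy[symmetric] in auto)
  ultimately show ?case using k by simp
qed

text \<open>
  A step of the algorithm is the recursion solved for the shifted tuple, so the recursion applied to
  the parameters found gives the coefficients back.
\<close>

lemma schur_fun_of_parameters:
  assumes "\<And>j. j < N \<Longrightarrow> norm ((peel ^^ j) c 1) < 1" "m \<in> {1..N}"
  shows "schur_fun m (\<lambda>i. (peel ^^ (i - 1)) c 1) = c m"
  using assms
proof (induction N arbitrary: c m)
  case (Suc N)
  let ?z = "\<lambda>i. (peel ^^ (i - 1)) c 1"
  have IH: "schur_fun k (\<lambda>i. (peel ^^ (i - 1)) (peel c) 1) = peel c k" if "k \<in> {1..N}" for k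
    by (rule Suc.IH) (use that Suc.prems(1)[of "Suc _"] in \<open>auto simp: funpow_swap1\<close>)
  have g: "peel c k = schur_fun k (\<lambda>i. ?z (Suc i))" if "k \<in> {1..N}" for k
  proof -
    have "schur_fun k (\<lambda>i. ?z (Suc i)) = schur_fun k (\<lambda>i. (peel ^^ (i - 1)) (peel c) 1)"
    proof (rule schur_fun_cong)
      fix i assume "i \<in> {1..k}"
      then obtain j where "i = Suc j" by (cases i) auto
      then show "(peel ^^ (Suc i - 1)) c 1 = (peel ^^ (i - 1)) (peel c) 1" by (simp add: funpow_swap1)
    qed
    then show ?thesis using IH[OF that] by simp
  qed
  have ne: "norm (c 1) \<noteq> 1" using Suc.prems(1)[of 0] by simp
  have "c m = schur_fun m ?z"
  proof (rule schur_fun_eqI[where g = "peel c" and N = "Suc N"])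
    fix m assume m: "2 \<le> m" "m \<le> Suc N"
    then obtain l where l: "m = Suc l" "l \<ge> 1" by (cases m) auto
    then show "c m = (1 - of_real ((norm (?z 1))\<^sup>2)) * peel c (m - 1) -
        cnj (?z 1) * (\<Sum>k\<in>{2..m-1}. peel c (m - k) * c k)"
      using of_real_norm_neq_1[OF ne] by (simp add: peel.simps[of c l] field_simps)
  qed (use g Suc.prems in auto)
  then show ?case by simp
qed simp

context inverse_closed_algebra
begin

lemma schur_fun:
  "(\<And>i. i \<in> {1..m} \<Longrightarrow> P (\<lambda>x. z x i)) \<Longrightarrow> P (\<lambda>x. schur_fun m (z x))"
proof (induction m arbitrary: z rule: less_induct)
  case (less m)
  consider "m = 0" | "m = 1" | "m \<ge> 2" by linarith
  then show ?case
  proof cases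
    case 1
    then show ?thesis by (simp add: schur_fun.simps const)
  next
    case 2
    then show ?thesis using less.prems by (simp add: schur_fun_1)
  next
    case 3
    have "P (\<lambda>x. (1 - of_real ((norm (z x 1))\<^sup>2)) * schur_fun (m - 1) (\<lambda>i. z x (Suc i))
           - cnj (z x 1) * (\<Sum>k\<in>{2..m-1}. schur_fun (m - k) (\<lambda>i. z x (Suc i)) * schur_fun k (z x)))"
      by (intro diff mult sum norm_squared conj const less.IH less.prems) (use 3 in auto)
    then show ?thesis by (simp add: schur_fun_rec[OF 3])
  qed
qed

lemma peel:
  assumes c: "\<And>i. i \<in> {1..Suc M} \<Longrightarrow> P (\<lambda>x. c x i)" and ne: "\<And>x. x \<in> U \<Longrightarrow> norm (c x 1) \<noteq> 1"
  shows "m \<in> {1..M} \<Longrightarrow> P (\<lambda>x. peel (c x) m)"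
proof (induction m rule: less_induct)
  case (less m)
  have "P (\<lambda>x. (c x (Suc m) + cnj (c x 1) * (\<Sum>k\<in>{2..m}. peel (c x) (Suc m - k) * c x k)) *
      inverse (1 - of_real ((norm (c x 1))\<^sup>2)))"
    by (intro mult add conj sum inverse diff const norm_squared c less.IH of_real_norm_neq_1 ne) (use less.prems in auto)
  then show ?case using less.prems by (simp add: peel.simps[of _ m] divide_inverse)
qed

lemma funpow_peel:
  assumes c: "\<And>i. i \<in> {1..N} \<Longrightarrow> P (\<lambda>x. c x i)"
  shows "(\<And>x j. x \<in> U \<Longrightarrow> j < k \<Longrightarrow> norm ((peel ^^ j) (c x) 1) \<noteq> 1) \<Longrightarrow> 1 \<le> m \<Longrightarrow> m + k \<le> N \<Longrightarrow>
    P (\<lambda>x. (peel ^^ k) (c x) m)"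
proof (induction k arbitrary: m)
  case 0
  then show ?case using c by simp
next
  case (Suc k)
  have "P (\<lambda>x. peel ((peel ^^ k) (c x)) m)"
    by (rule peel[where M = m]) (use Suc in auto)
  then show ?case by simp
qed

end

section \<open>The coefficient body of Schwarz functions\<close>

lemma holomorphic_has_fps_expansion:
  "f holomorphic_on ball 0 r \<Longrightarrow> r > 0 \<Longrightarrow> f has_fps_expansion fps_expansion f 0"
  by (rule has_fps_expansion_fps_expansion[of "ball 0 r"]) auto

lemma eventually_eq_imp_fps_eq:
  fixes f g :: "complex \<Rightarrow> complex"
  assumes "f has_fps_expansion F" "g has_fps_expansion G" "r > 0" "\<And>z. norm z < r \<Longrightarrow> f z = g z"
  shows "F = G"
proof -
  have "eventually (\<lambda>z. f z = g z) (nhds 0)"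
    using assms(3,4) by (intro eventually_nhds_in_open[of "ball 0 r", THEN eventually_mono]) auto
  then have "f has_fps_expansion G" using assms(2) has_fps_expansion_cong[of f g G G] by simp
  then show ?thesis by (rule fps_expansion_unique_complex[OF assms(1)])
qed

lemma fps_expansion_nth_0: "fps_expansion f 0 $ 0 = f 0"
  by (simp add: fps_expansion_def)

lemma fps_expansion_nth_1: "fps_expansion f 0 $ Suc 0 = deriv f 0"
  by (simp add: fps_expansion_def)

text \<open>
  Comparison of coefficients in the identity of one Schur step. The term with \<open>k = 1\<close> in the
  Cauchy product turns the coefficient of \<open>V $ (m - 1)\<close> into \<open>1 - c \<cdot> cnj c\<close>.
\<close>

lemma schur_step_coeffs:
  fixes W V :: "complex fps"
  assumes W0: "W $ 0 = 0" and V0: "V $ 0 = 0"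
    and rel: "W * (1 + fps_const (cnj c) * V) = fps_X * (fps_const c + V)"
  shows "W $ 1 = c"
    and "m \<ge> 2 \<Longrightarrow> W $ m = (1 - of_real ((norm c)\<^sup>2)) * V $ (m - 1) - cnj c * (\<Sum>k\<in>{2..m-1}. V $ (m - k) * W $ k)"
proof -
  have "W + fps_const (cnj c) * (W * V) = fps_X * (fps_const c + V)"
    using rel by (simp add: algebra_simps)
  then have nth: "W $ m + cnj c * (W * V) $ m = (fps_X * (fps_const c + V)) $ m" for m
    by (simp flip: fps_mult_left_const_nth fps_add_nth)
  show W1: "W $ 1 = c"
    using nth[of 1] W0 V0 by (simp add: fps_mult_nth)
  assume m: "m \<ge> 2"
  define l where "l = m - 2"
  with m have l: "m = Suc (Suc l)" by simp
  have "(W * V) $ m = (\<Sum>k=0..m. W $ k * V $ (m - k))" by (rule fps_mult_nth)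
  also have "\<dots> = (\<Sum>k=Suc (Suc 0)..Suc l. W $ k * V $ (m - k)) + c * V $ (m - 1)"
    unfolding l using W0 V0 W1 by (simp add: sum.atLeast_Suc_atMost sum.nat_ivl_Suc')
  also have "(\<Sum>k=Suc (Suc 0)..Suc l. W $ k * V $ (m - k)) = (\<Sum>k\<in>{2..m-1}. V $ (m - k) * W $ k)"
    by (intro sum.cong) (auto simp: l)
  finally show "W $ m = (1 - of_real ((norm c)\<^sup>2)) * V $ (m - 1) - cnj c * (\<Sum>k\<in>{2..m-1}. V $ (m - k) * W $ k)"
    using nth[of m] l unfolding complex_norm_square by (simp add: algebra_simps)
qed

lemma schwarz_step_schur_fun:
  assumes \<omega>: "\<omega> \<in> Omega" and \<nu>: "\<nu> \<in> Omega"
    and rel: "\<And>w. norm w < 1 \<Longrightarrow> \<omega> w * (1 + cnj (z 1) * \<nu> w) = w * (z 1 + \<nu> w)"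
    and V: "\<And>m. m \<in> {1..N} \<Longrightarrow> fps_expansion \<nu> 0 $ m = schur_fun m (\<lambda>i. z (Suc i))"
    and m: "m \<in> {1..Suc N}"
  shows "fps_expansion \<omega> 0 $ m = schur_fun m z"
proof -
  let ?W = "fps_expansion \<omega> 0" and ?V = "fps_expansion \<nu> 0"
  have W: "\<omega> has_fps_expansion ?W" and V': "\<nu> has_fps_expansion ?V"
    using \<omega> \<nu> by (auto simp: Omega_def intro!: holomorphic_has_fps_expansion[of _ 1])
  have "(\<lambda>w. \<omega> w * (1 + cnj (z 1) * \<nu> w)) has_fps_expansion ?W * (1 + fps_const (cnj (z 1)) * ?V)"
    by (intro fps_expansion_intros W V')
  moreover have "(\<lambda>w. w * (z 1 + \<nu> w)) has_fps_expansion fps_X * (fps_const (z 1) + ?V)"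
    by (intro fps_expansion_intros V')
  ultimately have eq: "?W * (1 + fps_const (cnj (z 1)) * ?V) = fps_X * (fps_const (z 1) + ?V)"
    by (rule eventually_eq_imp_fps_eq[OF _ _ zero_less_one rel])
  have "?W $ 0 = 0" "?V $ 0 = 0" using \<omega> \<nu> by (auto simp: Omega_def fps_expansion_nth_0)
  note st = schur_step_coeffs[OF this eq]
  show ?thesis
    by (rule schur_fun_eqI[where g = "\<lambda>m. ?V $ m" and N = "Suc N"]) (use st V m in auto)
qed

lemma rotation_in_Omega:
  assumes "norm \<alpha> = 1"
  shows "(\<lambda>w. \<alpha> * w) \<in> Omega"
  using assms by (auto simp: Omega_def norm_mult intro!: holomorphic_intros)

lemma rotation_schur_fun:
  assumes \<alpha>: "norm \<alpha> = 1" and \<omega>: "\<omega> \<in> Omega" "\<And>w. norm w < 1 \<Longrightarrow> \<omega> w = \<alpha> * w" and z: "z 1 = \<alpha>" and "m \<ge> 1"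
  shows "fps_expansion \<omega> 0 $ m = schur_fun m z"
proof -
  have "\<omega> has_fps_expansion fps_expansion \<omega> 0"
    using \<omega> by (auto simp: Omega_def intro!: holomorphic_has_fps_expansion[of _ 1])
  moreover have "(\<lambda>w. \<alpha> * w) has_fps_expansion fps_const \<alpha> * fps_X"
    by (intro fps_expansion_intros)
  ultimately have "fps_expansion \<omega> 0 = fps_const \<alpha> * fps_X"
    by (rule eventually_eq_imp_fps_eq[OF _ _ zero_less_one \<omega>(2)])
  then show ?thesis
    using \<open>m \<ge> 1\<close> schur_fun_unimodular_head[of z m] \<alpha> z by (cases "m = 1") (auto simp: schur_fun_1)
qed

text \<open>
  Schur's algorithm run backwards: compose with a Moebius transformation of the disc and
  multiply by the variable. A unimodular parameter ends the process with a rotation, after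
  which all further coefficients vanish, whatever the remaining parameters are.
\<close>

lemma schwarz_function_of_parameters:
  "(\<And>i. i \<in> {1..N} \<Longrightarrow> norm (z i) \<le> 1) \<Longrightarrow>
    \<exists>\<omega>\<in>Omega. \<forall>m\<in>{1..N}. fps_expansion \<omega> 0 $ m = schur_fun m z"
proof (induction N arbitrary: z)
  case 0
  show ?case using rotation_in_Omega[of 1] by auto
next
  case (Suc N)
  show ?case
  proof (cases "norm (z 1) = 1")
    case True
    have "\<forall>m\<in>{1..Suc N}. fps_expansion (\<lambda>w. z 1 * w) 0 $ m = schur_fun m z"
      using True rotation_in_Omega[OF True] by (auto intro!: rotation_schur_fun[of "z 1"])
    with rotation_in_Omega[OF True] show ?thesis by blast
  next
    case False
    then have c: "norm (z 1) < 1" using Suc.prems[of 1] by auto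
    from Suc.IH[of "\<lambda>i. z (Suc i)"] Suc.prems obtain \<nu> where \<nu>: "\<nu> \<in> Omega"
      and V: "\<And>m. m \<in> {1..N} \<Longrightarrow> fps_expansion \<nu> 0 $ m = schur_fun m (\<lambda>i. z (Suc i))" by auto
    have \<nu>1: "norm (\<nu> w) < 1" if "norm w < 1" for w
      using \<nu> that by (fastforce simp: Omega_def)
    have \<nu>hol: "\<nu> holomorphic_on ball 0 1" and \<nu>b: "\<nu> ` ball 0 1 \<subseteq> ball 0 1"
      using \<nu> by (auto simp: Omega_def)
    define \<mu> where "\<mu> = Moebius_function 0 (- z 1)"
    have \<mu>1: "norm (\<mu> w) < 1" if "norm w < 1" for w
      unfolding \<mu>_def by (rule Moebius_function_norm_lt_1) (use c that in auto)
    have "\<mu> holomorphic_on ball 0 1"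
      unfolding \<mu>_def by (rule Moebius_function_holomorphic) (use c in auto)
    then have "(\<mu> \<circ> \<nu>) holomorphic_on ball 0 1"
      by (intro holomorphic_on_compose_gen[OF \<nu>hol _ \<nu>b])
    then have "(\<lambda>w. w * (\<mu> \<circ> \<nu>) w) holomorphic_on ball 0 1"
      by (intro holomorphic_intros)
    moreover have "norm (w * (\<mu> \<circ> \<nu>) w) < 1" if "norm w < 1" for w
      using mult_strict_mono[OF that \<mu>1[OF \<nu>1[OF that]]] by (simp add: norm_mult)
    ultimately have \<omega>: "(\<lambda>w. w * (\<mu> \<circ> \<nu>) w) \<in> Omega"
      by (auto simp: Omega_def)
    have "w * (\<mu> \<circ> \<nu>) w * (1 + cnj (z 1) * \<nu> w) = w * (z 1 + \<nu> w)" if "norm w < 1" for w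
    proof -
      have "norm (cnj (z 1) * \<nu> w) < 1"
        using mult_strict_mono[OF c \<nu>1[OF that]] by (simp add: norm_mult)
      then have "1 + cnj (z 1) * \<nu> w \<noteq> 0"
        by (metis add.commute add_eq_0_iff2 norm_minus_cancel norm_one less_irrefl)
      then show ?thesis by (simp add: \<mu>_def Moebius_function_simple field_simps)
    qed
    from schwarz_step_schur_fun[OF \<omega> \<nu> this V]
    show ?thesis using \<omega> by blast
  qed
qed

text \<open>
  Schur's algorithm run forwards. By the Schwarz lemma \<open>\<omega>(w) / w\<close> either is a unimodular constant
  or maps into the open disc, and in the second case a Moebius transformation of the
  disc moves its value at \<open>0\<close> back to \<open>0\<close>.
\<close>

lemma parameters_of_schwarz_function:
  "\<omega> \<in> Omega \<Longrightarrow>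
    \<exists>z. (\<forall>i\<in>{1..N}. norm (z i) \<le> 1) \<and> (\<forall>m\<in>{1..N}. fps_expansion \<omega> 0 $ m = schur_fun m z)"
proof (induction N arbitrary: \<omega>)
  case (Suc N)
  have \<omega>1: "norm (\<omega> w) < 1" if "norm w < 1" for w
    using Suc.prems that by (fastforce simp: Omega_def)
  have hol: "\<omega> holomorphic_on ball 0 1" and \<omega>0: "\<omega> 0 = 0"
    using Suc.prems by (auto simp: Omega_def)
  show ?case
  proof (cases "\<exists>\<alpha>. (\<forall>w. norm w < 1 \<longrightarrow> \<omega> w = \<alpha> * w) \<and> norm \<alpha> = 1")
    case True
    then obtain \<alpha> where \<alpha>: "\<And>w. norm w < 1 \<Longrightarrow> \<omega> w = \<alpha> * w" "norm \<alpha> = 1" by blast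
    then have "fps_expansion \<omega> 0 $ m = schur_fun m (\<lambda>_. \<alpha>)" if "m \<in> {1..Suc N}" for m
      using that Suc.prems by (intro rotation_schur_fun[of \<alpha>]) auto
    then show ?thesis using \<alpha>(2) by (intro exI[of _ "\<lambda>_. \<alpha>"]) auto
  next
    case False
    obtain h where h: "h holomorphic_on ball 0 1" and \<omega>h: "\<And>w. norm w < 1 \<Longrightarrow> \<omega> w = w * h w"
      and dh: "deriv \<omega> 0 = h 0"
      using Schwarz3[OF hol \<omega>0] by blast
    have h1: "norm (h w) < 1" if w: "norm w < 1" for w
    proof (cases "w = 0")
      case True
      have "norm (deriv \<omega> 0) \<le> 1" by (rule Schwarz_Lemma(2)[OF hol \<omega>0 \<omega>1 w])
      moreover have "norm (deriv \<omega> 0) \<noteq> 1" using Schwarz_Lemma(3)[OF hol \<omega>0 \<omega>1 w] False by blast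
      ultimately show ?thesis using dh True by simp
    next
      case nz: False
      have "norm (\<omega> w) \<le> norm w" by (rule Schwarz_Lemma(1)[OF hol \<omega>0 \<omega>1 w])
      moreover have "norm (\<omega> w) \<noteq> norm w" using Schwarz_Lemma(3)[OF hol \<omega>0 \<omega>1 w] False nz w by blast
      ultimately show ?thesis using \<omega>h[OF w] nz by (simp add: norm_mult)
    qed
    \<comment> \<open>The parameter split off in this step is the first coefficient of \<open>\<omega>\<close>.\<close>
    define c where "c = h 0"
    have c: "norm c < 1" using h1[of 0] by (simp add: c_def)
    define \<nu> where "\<nu> = Moebius_function 0 c \<circ> h"
    have "Moebius_function 0 c holomorphic_on ball 0 1"
      by (rule Moebius_function_holomorphic[OF c])
    then have "\<nu> holomorphic_on ball 0 1"
      unfolding \<nu>_def by (rule holomorphic_on_compose_gen[OF h]) (use h1 in auto)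
    moreover have "norm (\<nu> w) < 1" if "norm w < 1" for w
      unfolding \<nu>_def comp_def by (rule Moebius_function_norm_lt_1[OF c h1[OF that]])
    moreover have "\<nu> 0 = 0" by (simp add: \<nu>_def c_def Moebius_function_eq_zero)
    ultimately have \<nu>: "\<nu> \<in> Omega" by (auto simp: Omega_def)
    have rel: "\<omega> w * (1 + cnj c * \<nu> w) = w * (c + \<nu> w)" if "norm w < 1" for w
    proof -
      have "norm (cnj c * h w) < 1"
        using mult_strict_mono[OF c h1[OF that]] by (simp add: norm_mult)
      then have ne: "1 - cnj c * h w \<noteq> 0"
        by (metis eq_iff_diff_eq_0 norm_one less_irrefl)
      then have "\<nu> w * (1 - cnj c * h w) = h w - c"
        by (simp add: \<nu>_def Moebius_function_simple)
      then have "h w * (1 + cnj c * \<nu> w) = c + \<nu> w" by (simp add: algebra_simps)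
      then show ?thesis using \<omega>h[OF that] by (simp add: mult.assoc)
    qed
    from Suc.IH[OF \<nu>] obtain y where y: "\<And>i. i \<in> {1..N} \<Longrightarrow> norm (y i) \<le> 1"
      "\<And>m. m \<in> {1..N} \<Longrightarrow> fps_expansion \<nu> 0 $ m = schur_fun m y" by blast
    define z where "z i = (if i = 1 then c else y (i - 1))" for i
    have "fps_expansion \<nu> 0 $ m = schur_fun m (\<lambda>i. z (Suc i))" if "m \<in> {1..N}" for m
    proof -
      have "schur_fun m y = schur_fun m (\<lambda>i. z (Suc i))"
        by (rule schur_fun_cong) (auto simp: z_def)
      then show ?thesis using y(2)[OF that] by simp
    qed
    then have "fps_expansion \<omega> 0 $ m = schur_fun m z" if "m \<in> {1..Suc N}" for m
      using that rel by (intro schwarz_step_schur_fun[OF Suc.prems \<nu>, where N = N]) (auto simp: z_def)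
    moreover have "norm (z i) \<le> 1" if "i \<in> {1..Suc N}" for i
    proof (cases "i = 1")
      case True then show ?thesis using c by (simp add: z_def)
    next
      case False
      then have "i - 1 \<in> {1..N}" using that by (cases i) auto
      then show ?thesis using y(1)[of "i - 1"] False by (simp add: z_def)
    qed
    ultimately show ?thesis by blast
  qed
qed simp

definition coefficient_body :: "nat \<Rightarrow> (nat \<Rightarrow> complex) set" where
  "coefficient_body N = (\<lambda>\<omega>. \<lambda>j\<in>{1..N}. fps_expansion \<omega> 0 $ j) ` Omega"

theorem coefficient_body_eq:
  "coefficient_body N = schur_transformation N ` ({1..N} \<rightarrow>\<^sub>E cball 0 1)"
proof (intro set_eqI iffI)
  fix c assume "c \<in> coefficient_body N"
  then obtain \<omega> where \<omega>: "\<omega> \<in> Omega" "c = (\<lambda>j\<in>{1..N}. fps_expansion \<omega> 0 $ j)"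
    by (auto simp: coefficient_body_def)
  obtain z where z: "\<And>i. i \<in> {1..N} \<Longrightarrow> norm (z i) \<le> 1"
    "\<And>m. m \<in> {1..N} \<Longrightarrow> fps_expansion \<omega> 0 $ m = schur_fun m z"
    using parameters_of_schwarz_function[OF \<omega>(1), of N] by blast
  have "schur_fun m (restrict z {1..N}) = schur_fun m z" if "m \<in> {1..N}" for m
    using that by (intro schur_fun_cong) auto
  then have "c = schur_transformation N (restrict z {1..N})"
    using z(2) by (auto simp: \<omega>(2) schur_transformation_def fun_eq_iff)
  moreover have "restrict z {1..N} \<in> {1..N} \<rightarrow>\<^sub>E cball 0 1" using z(1) by auto
  ultimately show "c \<in> schur_transformation N ` ({1..N} \<rightarrow>\<^sub>E cball 0 1)" by blast
next
  fix c assume "c \<in> schur_transformation N ` ({1..N} \<rightarrow>\<^sub>E cball 0 1)"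
  then obtain z where z: "z \<in> {1..N} \<rightarrow>\<^sub>E cball 0 1" "c = schur_transformation N z" by blast
  then have "norm (z i) \<le> 1" if "i \<in> {1..N}" for i using that by (auto simp: PiE_iff)
  from schwarz_function_of_parameters[of N z, OF this] obtain \<omega> where
    "\<omega> \<in> Omega" "\<And>m. m \<in> {1..N} \<Longrightarrow> fps_expansion \<omega> 0 $ m = schur_fun m z" by blast
  then show "c \<in> coefficient_body N"
    unfolding coefficient_body_def z(2) schur_transformation_def
    by (intro image_eqI[of _ _ \<omega>]) (auto simp: fun_eq_iff)
qed

section \<open>Real analyticity through absolutely convergent expansions\<close>

text \<open>
  Monomials in the \<open>2N\<close> real coordinates, with separate exponents for the real and the
  imaginary parts.
\<close>

definition monom2 :: "nat \<Rightarrow> (nat \<Rightarrow> 'a) \<Rightarrow> (nat \<Rightarrow> 'a) \<Rightarrow> (nat \<Rightarrow> nat) \<times> (nat \<Rightarrow> nat) \<Rightarrow> 'a::comm_semiring_1" where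
  "monom2 N x y \<gamma> = (\<Prod>i=1..N. x i ^ fst \<gamma> i * y i ^ snd \<gamma> i)"

abbreviation bi_indices :: "nat \<Rightarrow> ((nat \<Rightarrow> nat) \<times> (nat \<Rightarrow> nat)) set" where
  "bi_indices N \<equiv> multi_indices N \<times> multi_indices N"

abbreviation weight :: "nat \<Rightarrow> real \<Rightarrow> (nat \<Rightarrow> nat) \<times> (nat \<Rightarrow> nat) \<Rightarrow> real" where
  "weight N \<rho> \<equiv> monom2 N (\<lambda>_. \<rho>) (\<lambda>_. \<rho>)"

definition centred :: "nat \<Rightarrow> (nat \<Rightarrow> complex) \<Rightarrow> (nat \<Rightarrow> complex) \<Rightarrow> (nat \<Rightarrow> nat) \<times> (nat \<Rightarrow> nat) \<Rightarrow> complex" where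
  "centred N a z = monom2 N (\<lambda>i. of_real (Re (z i - a i))) (\<lambda>i. of_real (Im (z i - a i)))"

text \<open>
  Real analyticity by itself only asks for convergence. Products and reciprocals become manageable
  if the weighted \<open>\<ell>\<^sup>1\<close> norm of the coefficients at radius \<open>\<rho>\<close> is kept under control: functions with
  finite norm form a Banach algebra, and the bound \<open>M\<close> behaves like its norm.
\<close>

definition expansion_on :: "nat \<Rightarrow> (nat \<Rightarrow> complex) set \<Rightarrow> (nat \<Rightarrow> complex) \<Rightarrow> real \<Rightarrow> real \<Rightarrow>
    ((nat \<Rightarrow> complex) \<Rightarrow> complex) \<Rightarrow> bool" where
  "expansion_on N U a \<rho> M f \<longleftrightarrow> (\<exists>c.
     (\<lambda>\<gamma>. norm (c \<gamma>) * weight N \<rho> \<gamma>) summable_on bi_indices N \<and>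
     (\<Sum>\<^sub>\<infinity>\<gamma>\<in>bi_indices N. norm (c \<gamma>) * weight N \<rho> \<gamma>) \<le> M \<and>
     (\<forall>z\<in>U. (\<forall>i\<in>{1..N}. norm (z i - a i) < \<rho>) \<longrightarrow>
        ((\<lambda>\<gamma>. c \<gamma> * centred N a z \<gamma>) has_sum f z) (bi_indices N)))"

lemma weight_pos: "\<rho> > 0 \<Longrightarrow> weight N \<rho> \<gamma> > 0"
  unfolding monom2_def by (intro prod_pos) auto

lemma norm_centred_le_weight:
  assumes "\<forall>i\<in>{1..N}. norm (z i - a i) < \<rho>"
  shows "norm (centred N a z \<gamma>) \<le> weight N \<rho> \<gamma>"
  unfolding centred_def monom2_def prod_norm[symmetric] norm_mult norm_power
proof (intro prod_mono conjI mult_mono power_mono)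
  fix i assume "i \<in> {1..N}"
  with assms have "norm (z i - a i) < \<rho>" by blast
  then show "norm (complex_of_real (Re (z i - a i))) \<le> \<rho>"
    and "norm (complex_of_real (Im (z i - a i))) \<le> \<rho>"
    and "0 \<le> \<rho> ^ fst \<gamma> i"
    using abs_Re_le_cmod[of "z i - a i"] abs_Im_le_cmod[of "z i - a i"] norm_ge_zero[of "z i - a i"]
    unfolding norm_of_real by (linarith, linarith, intro zero_le_power, linarith)
qed auto

text \<open>
  Families of monomials with repetitions, indexed by an arbitrary set, may be collected by exponent:
  absolute convergence allows the summation to be carried out fibre by fibre, and the norm can
  only decrease. Sums, products and infinite series of expansions are all obtained in this way.
\<close>

lemma expansion_on_regroup:
  fixes I :: "'i set" and d :: "'i \<Rightarrow> complex"
  assumes \<rho>: "\<rho> > 0" and mi: "\<And>i. i \<in> I \<Longrightarrow> mi i \<in> bi_indices N"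
    and sm: "((\<lambda>i. norm (d i) * weight N \<rho> (mi i)) has_sum S) I" and SM: "S \<le> M"
    and f: "\<And>z. z \<in> U \<Longrightarrow> (\<forall>i\<in>{1..N}. norm (z i - a i) < \<rho>) \<Longrightarrow>
        ((\<lambda>i. d i * centred N a z (mi i)) has_sum f z) I"
  shows "expansion_on N U a \<rho> M f"
proof -
  let ?G = "bi_indices N"
  define B where "B \<gamma> = {i\<in>I. mi i = \<gamma>}" for \<gamma>
  \<comment> \<open>The index set is the disjoint union of its fibres over the exponents.\<close>
  have bij: "bij_betw (\<lambda>i. (mi i, i)) I (Sigma ?G B)"
    by (rule bij_betwI[of _ _ _ snd]) (use mi in \<open>auto simp: B_def\<close>)
  have tot: "((\<lambda>(\<gamma>, i). norm (d i) * weight N \<rho> \<gamma>) has_sum S) (Sigma ?G B)"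
    using has_sum_reindex_bij_betw[OF bij, of "\<lambda>(\<gamma>, i). norm (d i) * weight N \<rho> \<gamma>" S] sm by simp
  have inner0: "(\<lambda>i. norm (d i) * weight N \<rho> \<gamma>) summable_on B \<gamma>" if "\<gamma> \<in> ?G" for \<gamma>
    using summable_on_SigmaD1[of "\<lambda>\<gamma> i. norm (d i) * weight N \<rho> \<gamma>" ?G B \<gamma>] that tot
    by (auto simp: summable_on_def)
  have inner: "(\<lambda>i. norm (d i)) summable_on B \<gamma>" if "\<gamma> \<in> ?G" for \<gamma>
  proof -
    have "(\<lambda>i. (norm (d i) * weight N \<rho> \<gamma>) * inverse (weight N \<rho> \<gamma>)) summable_on B \<gamma>"
      by (rule summable_on_cmult_left[OF inner0[OF that]])
    then show ?thesis using weight_pos[OF \<rho>, of N \<gamma>] by (simp add: field_simps)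
  qed
  define c where "c \<gamma> = infsum d (B \<gamma>)" for \<gamma>
  have c: "(d has_sum c \<gamma>) (B \<gamma>)" if "\<gamma> \<in> ?G" for \<gamma>
    unfolding c_def using abs_summable_summable[OF inner[OF that]] by simp
  have cn: "norm (c \<gamma>) \<le> (\<Sum>\<^sub>\<infinity>i\<in>B \<gamma>. norm (d i))" if "\<gamma> \<in> ?G" for \<gamma>
    unfolding c_def using norm_infsum_bound[OF inner[OF that]] .
  have outer: "((\<lambda>\<gamma>. (\<Sum>\<^sub>\<infinity>i\<in>B \<gamma>. norm (d i)) * weight N \<rho> \<gamma>) has_sum S) ?G"
  proof (rule has_sum_SigmaD[OF tot])
    fix \<gamma> assume "\<gamma> \<in> ?G"
    then show "((\<lambda>i. case (\<gamma>, i) of (\<gamma>, i) \<Rightarrow> norm (d i) * weight N \<rho> \<gamma>) has_sum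
        (\<Sum>\<^sub>\<infinity>i\<in>B \<gamma>. norm (d i)) * weight N \<rho> \<gamma>) (B \<gamma>)"
      using has_sum_cmult_left[OF has_sum_infsum[OF inner]] by simp
  qed
  have le: "norm (c \<gamma>) * weight N \<rho> \<gamma> \<le> (\<Sum>\<^sub>\<infinity>i\<in>B \<gamma>. norm (d i)) * weight N \<rho> \<gamma>" if "\<gamma> \<in> ?G" for \<gamma>
    using cn[OF that] weight_pos[OF \<rho>, of N \<gamma>] by (intro mult_right_mono) auto
  have summ: "(\<lambda>\<gamma>. norm (c \<gamma>) * weight N \<rho> \<gamma>) summable_on ?G"
    by (rule summable_on_comparison_test[OF has_sum_imp_summable[OF outer]])
      (use le weight_pos[OF \<rho>, of N] in \<open>auto simp: less_imp_le\<close>)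
  moreover have "(\<Sum>\<^sub>\<infinity>\<gamma>\<in>?G. norm (c \<gamma>) * weight N \<rho> \<gamma>) \<le> M"
    using has_sum_mono[OF has_sum_infsum[OF summ] outer le] SM by simp
  moreover have "((\<lambda>\<gamma>. c \<gamma> * centred N a z \<gamma>) has_sum f z) ?G"
    if "z \<in> U" "\<forall>i\<in>{1..N}. norm (z i - a i) < \<rho>" for z
  proof (rule has_sum_SigmaD)
    show "((\<lambda>(\<gamma>, i). d i * centred N a z \<gamma>) has_sum f z) (Sigma ?G B)"
      using has_sum_reindex_bij_betw[OF bij, of "\<lambda>(\<gamma>, i). d i * centred N a z \<gamma>" "f z"] f[OF that] by simp
    show "((\<lambda>i. case (\<gamma>, i) of (\<gamma>, i) \<Rightarrow> d i * centred N a z \<gamma>) has_sum c \<gamma> * centred N a z \<gamma>) (B \<gamma>)"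
      if "\<gamma> \<in> ?G" for \<gamma>
      using has_sum_cmult_left[OF c[OF that]] by simp
  qed
  ultimately show ?thesis unfolding expansion_on_def by blast
qed

lemma expansion_on_norm_le:
  assumes "\<rho> > 0" "expansion_on N U a \<rho> M f" "z \<in> U" "\<forall>i\<in>{1..N}. norm (z i - a i) < \<rho>"
  shows "norm (f z) \<le> M"
proof -
  from assms(2) obtain c where c: "(\<lambda>\<gamma>. norm (c \<gamma>) * weight N \<rho> \<gamma>) summable_on bi_indices N"
    "(\<Sum>\<^sub>\<infinity>\<gamma>\<in>bi_indices N. norm (c \<gamma>) * weight N \<rho> \<gamma>) \<le> M"
    "((\<lambda>\<gamma>. c \<gamma> * centred N a z \<gamma>) has_sum f z) (bi_indices N)"
    using assms(3,4) unfolding expansion_on_def by blast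
  have le: "norm (c \<gamma> * centred N a z \<gamma>) \<le> norm (c \<gamma>) * weight N \<rho> \<gamma>" for \<gamma>
    unfolding norm_mult by (intro mult_left_mono norm_centred_le_weight[OF assms(4)]) simp
  have s: "(\<lambda>\<gamma>. norm (c \<gamma> * centred N a z \<gamma>)) summable_on bi_indices N"
    by (rule summable_on_comparison_test[OF c(1) le]) simp
  have "norm (f z) \<le> (\<Sum>\<^sub>\<infinity>\<gamma>\<in>bi_indices N. norm (c \<gamma> * centred N a z \<gamma>))"
    by (rule norm_has_sum_bound[OF has_sum_infsum[OF s] c(3)])
  also have "\<dots> \<le> (\<Sum>\<^sub>\<infinity>\<gamma>\<in>bi_indices N. norm (c \<gamma>) * weight N \<rho> \<gamma>)"
    by (rule infsum_mono[OF s c(1) le])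
  finally show ?thesis using c(2) by (rule order_trans)
qed

lemma expansion_on_suminf:
  fixes h :: "'k \<Rightarrow> (nat \<Rightarrow> complex) \<Rightarrow> complex" and J :: "'k set"
  assumes \<rho>: "\<rho> > 0" and h: "\<And>k. k \<in> J \<Longrightarrow> expansion_on N U a \<rho> (M k) (h k)"
    and M: "(M has_sum S) J"
    and f: "\<And>z. z \<in> U \<Longrightarrow> (\<forall>i\<in>{1..N}. norm (z i - a i) < \<rho>) \<Longrightarrow> ((\<lambda>k. h k z) has_sum f z) J"
  shows "expansion_on N U a \<rho> S f"
proof -
  let ?G = "bi_indices N"
  have "\<exists>c. \<forall>k\<in>J. (\<lambda>\<gamma>. norm (c k \<gamma>) * weight N \<rho> \<gamma>) summable_on ?G \<and>
      (\<Sum>\<^sub>\<infinity>\<gamma>\<in>?G. norm (c k \<gamma>) * weight N \<rho> \<gamma>) \<le> M k \<and>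
      (\<forall>z\<in>U. (\<forall>i\<in>{1..N}. norm (z i - a i) < \<rho>) \<longrightarrow>
        ((\<lambda>\<gamma>. c k \<gamma> * centred N a z \<gamma>) has_sum h k z) ?G)"
    using h unfolding expansion_on_def by (intro bchoice) blast
  then obtain c where c: "\<And>k. k \<in> J \<Longrightarrow> (\<lambda>\<gamma>. norm (c k \<gamma>) * weight N \<rho> \<gamma>) summable_on ?G"
     "\<And>k. k \<in> J \<Longrightarrow> (\<Sum>\<^sub>\<infinity>\<gamma>\<in>?G. norm (c k \<gamma>) * weight N \<rho> \<gamma>) \<le> M k"
     "\<And>k z. k \<in> J \<Longrightarrow> z \<in> U \<Longrightarrow> (\<forall>i\<in>{1..N}. norm (z i - a i) < \<rho>) \<Longrightarrow>
        ((\<lambda>\<gamma>. c k \<gamma> * centred N a z \<gamma>) has_sum h k z) ?G"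
    by blast
  define W where "W k = (\<Sum>\<^sub>\<infinity>\<gamma>\<in>?G. norm (c k \<gamma>) * weight N \<rho> \<gamma>)" for k
  have W0: "W k \<ge> 0" for k unfolding W_def
    using weight_pos[OF \<rho>] by (intro infsum_nonneg) (auto intro!: mult_nonneg_nonneg simp: less_imp_le)
  have Ws: "W summable_on J"
    by (rule summable_on_comparison_test[OF has_sum_imp_summable[OF M]]) (use c(2) W0 in \<open>auto simp: W_def\<close>)
  have WM: "infsum W J \<le> S"
    using has_sum_mono[OF has_sum_infsum[OF Ws] M] c(2) by (simp add: W_def)
  have inner: "((\<lambda>\<gamma>. norm (c k \<gamma>) * weight N \<rho> \<gamma>) has_sum W k) ?G" if "k \<in> J" for k
    using c(1)[OF that] by (simp add: W_def)
  have s: "(\<lambda>(k,\<gamma>). norm (c k \<gamma>) * weight N \<rho> \<gamma>) summable_on (J \<times> ?G)"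
    by (rule summable_on_SigmaI[where g = W])
     (use inner Ws weight_pos[OF \<rho>, of N] in \<open>auto intro!: mult_nonneg_nonneg simp: less_imp_le\<close>)
  have hs: "((\<lambda>(k,\<gamma>). norm (c k \<gamma>) * weight N \<rho> \<gamma>) has_sum infsum W J) (J \<times> ?G)"
    by (rule has_sum_SigmaI[where g = W]) (use inner Ws s in \<open>auto\<close>)
  show ?thesis
  proof (rule expansion_on_regroup[OF \<rho>, where I = "J \<times> ?G" and mi = snd and d = "\<lambda>(k,\<gamma>). c k \<gamma>"])
    show "((\<lambda>i. norm (case i of (k, \<gamma>) \<Rightarrow> c k \<gamma>) * weight N \<rho> (snd i)) has_sum infsum W J) (J \<times> ?G)"
      using hs by (simp add: case_prod_unfold)
    show "infsum W J \<le> S" by fact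
    fix z assume z: "z \<in> U" "\<forall>i\<in>{1..N}. norm (z i - a i) < \<rho>"
    have "(\<lambda>(k,\<gamma>). c k \<gamma> * centred N a z \<gamma>) summable_on (J \<times> ?G)"
    proof (rule abs_summable_summable, rule summable_on_comparison_test[OF s])
      fix x assume "x \<in> J \<times> ?G"
      show "norm (case x of (k,\<gamma>) \<Rightarrow> c k \<gamma> * centred N a z \<gamma>) \<le> (case x of (k,\<gamma>) \<Rightarrow> norm (c k \<gamma>) * weight N \<rho> \<gamma>)"
        by (auto simp: norm_mult case_prod_unfold intro!: mult_left_mono norm_centred_le_weight[OF z(2)])
    qed simp
    then have "((\<lambda>(k,\<gamma>). c k \<gamma> * centred N a z \<gamma>) has_sum f z) (J \<times> ?G)"
      by (intro has_sum_SigmaI[where g = "\<lambda>k. h k z"]) (use c(3)[OF _ z] f[OF z] in auto)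
    then show "((\<lambda>i. (case i of (k, \<gamma>) \<Rightarrow> c k \<gamma>) * centred N a z (snd i)) has_sum f z) (J \<times> ?G)"
      by (simp add: case_prod_unfold)
  qed auto
qed

lemma expansion_on_add:
  assumes \<rho>: "\<rho> > 0" and f: "expansion_on N U a \<rho> M f" and g: "expansion_on N U a \<rho> M' g"
  shows "expansion_on N U a \<rho> (M + M') (\<lambda>z. f z + g z)"
  by (rule expansion_on_suminf[OF \<rho>, where J = "UNIV :: bool set" and h = "\<lambda>b. if b then f else g"
        and M = "\<lambda>b. if b then M else M'"])
    (use f g in \<open>auto simp: UNIV_bool has_sum_finite_iff\<close>)

lemma monom2_add:
  "monom2 N x y (\<lambda>i\<in>{1..N}. fst \<gamma> i + fst \<delta> i, \<lambda>i\<in>{1..N}. snd \<gamma> i + snd \<delta> i)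
     = monom2 N x y \<gamma> * monom2 N x y \<delta>"
  unfolding monom2_def prod.distrib[symmetric]
  by (rule prod.cong) (auto simp: power_add mult_ac)

lemma expansion_on_mult:
  assumes \<rho>: "\<rho> > 0" and f: "expansion_on N U a \<rho> M f" and g: "expansion_on N U a \<rho> M' g"
  shows "expansion_on N U a \<rho> (M * M') (\<lambda>z. f z * g z)"
proof -
  let ?G = "bi_indices N"
  let ?w = "weight N \<rho>"
  let ?add = "\<lambda>(\<gamma>, \<delta>). (\<lambda>i\<in>{1..N}. fst \<gamma> i + fst \<delta> i :: nat, \<lambda>i\<in>{1..N}. snd \<gamma> i + snd \<delta> i :: nat)"
  from f obtain c where c: "(\<lambda>\<gamma>. norm (c \<gamma>) * ?w \<gamma>) summable_on ?G"
     "(\<Sum>\<^sub>\<infinity>\<gamma>\<in>?G. norm (c \<gamma>) * ?w \<gamma>) \<le> M"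
     "\<And>z. z \<in> U \<Longrightarrow> (\<forall>i\<in>{1..N}. norm (z i - a i) < \<rho>) \<Longrightarrow> ((\<lambda>\<gamma>. c \<gamma> * centred N a z \<gamma>) has_sum f z) ?G"
    unfolding expansion_on_def by blast
  from g obtain d where d: "(\<lambda>\<gamma>. norm (d \<gamma>) * ?w \<gamma>) summable_on ?G"
     "(\<Sum>\<^sub>\<infinity>\<gamma>\<in>?G. norm (d \<gamma>) * ?w \<gamma>) \<le> M'"
     "\<And>z. z \<in> U \<Longrightarrow> (\<forall>i\<in>{1..N}. norm (z i - a i) < \<rho>) \<Longrightarrow> ((\<lambda>\<gamma>. d \<gamma> * centred N a z \<gamma>) has_sum g z) ?G"
    unfolding expansion_on_def by blast
  define A where "A = (\<Sum>\<^sub>\<infinity>\<gamma>\<in>?G. norm (c \<gamma>) * ?w \<gamma>)"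
  define B where "B = (\<Sum>\<^sub>\<infinity>\<gamma>\<in>?G. norm (d \<gamma>) * ?w \<gamma>)"
  have A: "((\<lambda>\<gamma>. norm (c \<gamma>) * ?w \<gamma>) has_sum A) ?G" and B: "((\<lambda>\<gamma>. norm (d \<gamma>) * ?w \<gamma>) has_sum B) ?G"
    using c(1) d(1) by (simp_all add: A_def B_def)
  have w0: "?w \<gamma> \<ge> 0" for \<gamma> using weight_pos[OF \<rho>, of N \<gamma>] by simp
  have A0: "A \<ge> 0" and B0: "B \<ge> 0"
    unfolding A_def B_def using w0 by (auto intro!: infsum_nonneg mult_nonneg_nonneg)
  have in1: "((\<lambda>\<delta>. (norm (c \<gamma>) * ?w \<gamma>) * (norm (d \<delta>) * ?w \<delta>)) has_sum (norm (c \<gamma>) * ?w \<gamma>) * B) ?G" for \<gamma>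
    by (rule has_sum_cmult_right[OF B])
  have out1: "((\<lambda>\<gamma>. (norm (c \<gamma>) * ?w \<gamma>) * B) has_sum A * B) ?G"
    by (rule has_sum_cmult_left[OF A])
  have s: "(\<lambda>(\<gamma>,\<delta>). (norm (c \<gamma>) * ?w \<gamma>) * (norm (d \<delta>) * ?w \<delta>)) summable_on (?G \<times> ?G)"
    by (rule summable_on_SigmaI[where g = "\<lambda>\<gamma>. (norm (c \<gamma>) * ?w \<gamma>) * B"])
     (use in1 has_sum_imp_summable[OF out1] w0 in \<open>auto intro!: mult_nonneg_nonneg\<close>)
  have hs: "((\<lambda>(\<gamma>,\<delta>). (norm (c \<gamma>) * ?w \<gamma>) * (norm (d \<delta>) * ?w \<delta>)) has_sum A * B) (?G \<times> ?G)"
    by (rule has_sum_SigmaI[where g = "\<lambda>\<gamma>. (norm (c \<gamma>) * ?w \<gamma>) * B"]) (use in1 out1 s in auto)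
  show ?thesis
  proof (rule expansion_on_regroup[OF \<rho>, where I = "?G \<times> ?G" and mi = ?add and d = "\<lambda>(\<gamma>,\<delta>). c \<gamma> * d \<delta>"])
    show "?add i \<in> ?G" for i by (cases i) (auto simp: multi_indices_def)
    show "((\<lambda>i. norm (case i of (\<gamma>, \<delta>) \<Rightarrow> c \<gamma> * d \<delta>) * ?w (?add i)) has_sum A * B) (?G \<times> ?G)"
      by (rule has_sum_cong[THEN iffD1, OF _ hs]) (auto simp: monom2_add[of N _ _ "(_, _)" "(_, _)", unfolded fst_conv snd_conv] norm_mult simp del: One_nat_def)
    show "A * B \<le> M * M'"
      using c(2) d(2) A0 B0 unfolding A_def[symmetric] B_def[symmetric] by (intro mult_mono) auto
    fix z assume z: "z \<in> U" "\<forall>i\<in>{1..N}. norm (z i - a i) < \<rho>"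
    have "(\<lambda>(\<gamma>,\<delta>). (c \<gamma> * centred N a z \<gamma>) * (d \<delta> * centred N a z \<delta>)) summable_on (?G \<times> ?G)"
    proof (rule abs_summable_summable, rule summable_on_comparison_test[OF s])
      fix x assume "x \<in> ?G \<times> ?G"
      show "norm (case x of (\<gamma>,\<delta>) \<Rightarrow> (c \<gamma> * centred N a z \<gamma>) * (d \<delta> * centred N a z \<delta>))
         \<le> (case x of (\<gamma>,\<delta>) \<Rightarrow> (norm (c \<gamma>) * ?w \<gamma>) * (norm (d \<delta>) * ?w \<delta>))"
        unfolding case_prod_unfold norm_mult
        by (intro mult_mono mult_nonneg_nonneg norm_centred_le_weight[OF z(2)] norm_ge_zero order_refl w0)
    qed simp
    then have "((\<lambda>(\<gamma>,\<delta>). (c \<gamma> * centred N a z \<gamma>) * (d \<delta> * centred N a z \<delta>)) has_sum f z * g z) (?G \<times> ?G)"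
      by (intro has_sum_SigmaI[where g = "\<lambda>\<gamma>. (c \<gamma> * centred N a z \<gamma>) * g z"])
        (use has_sum_cmult_left[OF c(3)[OF z]] has_sum_cmult_right[OF d(3)[OF z]] in auto)
    then show "((\<lambda>i. (case i of (\<gamma>, \<delta>) \<Rightarrow> c \<gamma> * d \<delta>) * centred N a z (?add i)) has_sum f z * g z) (?G \<times> ?G)"
      by (simp add: case_prod_unfold centred_def monom2_add mult_ac del: One_nat_def)
  qed
qed

lemma expansion_on_power:
  assumes \<rho>: "\<rho> > 0" and f: "expansion_on N U a \<rho> M f" and one: "expansion_on N U a \<rho> 1 (\<lambda>_. 1)"
  shows "expansion_on N U a \<rho> (M ^ k) (\<lambda>z. f z ^ k)"
  by (induction k) (use one expansion_on_mult[OF \<rho> f] in auto)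

text \<open>
  The Neumann series of the Banach algebra.
\<close>

lemma expansion_on_geometric:
  assumes \<rho>: "\<rho> > 0" and f: "expansion_on N U a \<rho> M f" and one: "expansion_on N U a \<rho> 1 (\<lambda>_. 1)"
    and M: "0 \<le> M" "M < 1"
  shows "expansion_on N U a \<rho> (1 / (1 - M)) (\<lambda>z. 1 / (1 - f z))"
proof (rule expansion_on_suminf[OF \<rho>, where J = UNIV and h = "\<lambda>k z. f z ^ k" and M = "\<lambda>k. M ^ k"])
  show "expansion_on N U a \<rho> (M ^ k) (\<lambda>z. f z ^ k)" for k
    by (rule expansion_on_power[OF \<rho> f one])
  have sumsI: "((\<lambda>k. x ^ k) has_sum 1 / (1 - x)) UNIV" if "norm x < 1" for x :: "'x::{real_normed_field, banach}"
    using that geometric_sums[OF that] summable_geometric[of "norm x"]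
    by (intro norm_summable_imp_has_sum) (auto simp: norm_power)
  show "((\<lambda>k. M ^ k) has_sum 1 / (1 - M)) UNIV" by (rule sumsI) (use M in auto)
  show "((\<lambda>k. f z ^ k) has_sum 1 / (1 - f z)) UNIV"
    if "z \<in> U" "\<forall>i\<in>{1..N}. norm (z i - a i) < \<rho>" for z
    by (rule sumsI) (use expansion_on_norm_le[OF \<rho> f that] M in auto)
qed

lemma bi_index_nonzero:
  assumes "\<gamma> \<in> bi_indices N" "\<gamma> \<noteq> (\<lambda>i\<in>{1..N}. 0, \<lambda>i\<in>{1..N}. 0)"
  shows "\<exists>i\<in>{1..N}. fst \<gamma> i \<noteq> 0 \<or> snd \<gamma> i \<noteq> 0"
proof (rule ccontr)
  assume "\<not> ?thesis"
  then have "fst \<gamma> = (\<lambda>i\<in>{1..N}. 0)" "snd \<gamma> = (\<lambda>i\<in>{1..N}. 0)"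
    using assms(1) by (auto simp: multi_indices_def PiE_def extensional_def)
  then have "\<gamma> = (\<lambda>i\<in>{1..N}. 0, \<lambda>i\<in>{1..N}. 0)"
    by (metis prod.collapse)
  with assms(2) show False by simp
qed

lemma weight_shrink:
  assumes "0 < t" "t \<le> \<rho>" "\<gamma> \<in> bi_indices N" "\<gamma> \<noteq> (\<lambda>i\<in>{1..N}. 0, \<lambda>i\<in>{1..N}. 0)"
  shows "weight N t \<gamma> \<le> t / \<rho> * weight N \<rho> \<gamma>"
proof -
  define s where "s = t / \<rho>"
  have s: "0 < s" "s \<le> 1" "t = s * \<rho>" using assms(1,2) by (auto simp: s_def field_simps)
  define n where "n = (\<Sum>i=1..N. fst \<gamma> i + snd \<gamma> i)"
  have "n \<noteq> 0"
    using bi_index_nonzero[OF assms(3,4)] by (auto simp: n_def)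
  then have "s ^ n \<le> s" using s power_decreasing[of 1 n s] by simp
  have "weight N t \<gamma> = s ^ n * weight N \<rho> \<gamma>"
    unfolding monom2_def n_def power_sum prod.distrib[symmetric] s(3)
    by (rule prod.cong) (auto simp: power_mult_distrib power_add)
  also have "\<dots> \<le> s * weight N \<rho> \<gamma>"
    using \<open>s ^ n \<le> s\<close> weight_pos[of \<rho> N \<gamma>] assms(1,2) by (intro mult_right_mono) auto
  finally show ?thesis by (simp add: s_def)
qed

text \<open>
  Without a constant term, the norm tends to \<open>0\<close> with the radius, because each monomial that occurs
  has degree at least one. This provides the smallness that the geometric series needs.
\<close>

lemma expansion_on_shrink:
  assumes t: "0 < t" "t \<le> \<rho>" and f: "expansion_on N U a \<rho> M f" and a: "a \<in> U" "f a = 0"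
  shows "expansion_on N U a t (t / \<rho> * M) f"
proof -
  let ?G = "bi_indices N"
  let ?o = "(\<lambda>i\<in>{1..N}. 0, \<lambda>i\<in>{1..N}. 0) :: (nat \<Rightarrow> nat) \<times> (nat \<Rightarrow> nat)"
  from f obtain c where c: "(\<lambda>\<gamma>. norm (c \<gamma>) * weight N \<rho> \<gamma>) summable_on ?G"
     "(\<Sum>\<^sub>\<infinity>\<gamma>\<in>?G. norm (c \<gamma>) * weight N \<rho> \<gamma>) \<le> M"
     "\<And>z. z \<in> U \<Longrightarrow> (\<forall>i\<in>{1..N}. norm (z i - a i) < \<rho>) \<Longrightarrow> ((\<lambda>\<gamma>. c \<gamma> * centred N a z \<gamma>) has_sum f z) ?G"
    unfolding expansion_on_def by blast
  have o: "?o \<in> ?G" by (auto simp: multi_indices_def)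
  \<comment> \<open>At the centre only the constant monomial survives.\<close>
  have c0: "c ?o = 0"
  proof -
    have z: "centred N a a \<gamma> = (if \<gamma> = ?o then 1 else 0)" if \<gamma>: "\<gamma> \<in> ?G" for \<gamma>
    proof (cases "\<gamma> = ?o")
      case True then show ?thesis by (simp add: centred_def monom2_def)
    next
      case False
      then obtain i where i: "i \<in> {1..N}" "fst \<gamma> i \<noteq> 0 \<or> snd \<gamma> i \<noteq> 0"
        using bi_index_nonzero[OF \<gamma>] by blast
      then have "centred N a a \<gamma> = 0" unfolding centred_def monom2_def
        by (intro prod_zero) (auto intro!: bexI[of _ i])
      then show ?thesis using False by simp
    qed
    have "((\<lambda>\<gamma>. c \<gamma> * centred N a a \<gamma>) has_sum f a) ?G" using c(3)[of a] a t by simp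
    moreover have "((\<lambda>\<gamma>. c \<gamma> * centred N a a \<gamma>) has_sum c ?o) ?G"
      by (rule has_sum_finite_neutralI[of "{?o}"]) (use o z in auto)
    ultimately have "f a = c ?o" by (rule has_sum_unique)
    then show ?thesis using a(2) by simp
  qed
  have w0: "0 \<le> weight N t \<gamma>" for \<gamma> using weight_pos[OF t(1), of N \<gamma>] by simp
  have le: "norm (c \<gamma>) * weight N t \<gamma> \<le> t / \<rho> * (norm (c \<gamma>) * weight N \<rho> \<gamma>)" if "\<gamma> \<in> ?G" for \<gamma>
  proof (cases "\<gamma> = ?o")
    case True then show ?thesis using c0 by simp
  next
    case False
    then have "norm (c \<gamma>) * weight N t \<gamma> \<le> norm (c \<gamma>) * (t / \<rho> * weight N \<rho> \<gamma>)"
      by (intro mult_left_mono weight_shrink t that) auto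
    then show ?thesis by (simp add: mult_ac)
  qed
  have s': "(\<lambda>\<gamma>. t / \<rho> * (norm (c \<gamma>) * weight N \<rho> \<gamma>)) summable_on ?G"
    by (rule summable_on_cmult_right[OF c(1)])
  have s: "(\<lambda>\<gamma>. norm (c \<gamma>) * weight N t \<gamma>) summable_on ?G"
    by (rule summable_on_comparison_test[OF s' le]) (use w0 in auto)
  have "(\<Sum>\<^sub>\<infinity>\<gamma>\<in>?G. norm (c \<gamma>) * weight N t \<gamma>) \<le> (\<Sum>\<^sub>\<infinity>\<gamma>\<in>?G. t / \<rho> * (norm (c \<gamma>) * weight N \<rho> \<gamma>))"
    by (rule infsum_mono[OF s s' le])
  also have "\<dots> = t / \<rho> * (\<Sum>\<^sub>\<infinity>\<gamma>\<in>?G. norm (c \<gamma>) * weight N \<rho> \<gamma>)" by (rule infsum_cmult_right')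
  also have "\<dots> \<le> t / \<rho> * M" using c(2) t by (intro mult_left_mono) auto
  finally show ?thesis unfolding expansion_on_def using s c(3) t by (intro exI[of _ c]) force
qed

definition abs_analytic_on :: "nat \<Rightarrow> (nat \<Rightarrow> complex) set \<Rightarrow> ((nat \<Rightarrow> complex) \<Rightarrow> complex) \<Rightarrow> bool" where
  "abs_analytic_on N U f \<longleftrightarrow> (\<forall>a\<in>U. \<exists>\<rho>>0. \<exists>M. expansion_on N U a \<rho> M f)"

lemma expansion_on_smaller:
  assumes "0 < t" "t \<le> \<rho>" and f: "expansion_on N U a \<rho> M f"
  shows "expansion_on N U a t M f"
proof -
  let ?G = "bi_indices N"
  from f obtain c where c: "(\<lambda>\<gamma>. norm (c \<gamma>) * weight N \<rho> \<gamma>) summable_on ?G"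
     "(\<Sum>\<^sub>\<infinity>\<gamma>\<in>?G. norm (c \<gamma>) * weight N \<rho> \<gamma>) \<le> M"
     "\<And>z. z \<in> U \<Longrightarrow> (\<forall>i\<in>{1..N}. norm (z i - a i) < \<rho>) \<Longrightarrow> ((\<lambda>\<gamma>. c \<gamma> * centred N a z \<gamma>) has_sum f z) ?G"
    unfolding expansion_on_def by blast
  have w0: "0 \<le> weight N t \<gamma>" for \<gamma> using weight_pos[OF assms(1), of N \<gamma>] by simp
  have le: "norm (c \<gamma>) * weight N t \<gamma> \<le> norm (c \<gamma>) * weight N \<rho> \<gamma>" for \<gamma>
    unfolding monom2_def using assms(1,2) by (intro mult_left_mono prod_mono conjI mult_mono power_mono) auto
  have s: "(\<lambda>\<gamma>. norm (c \<gamma>) * weight N t \<gamma>) summable_on ?G"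
    by (rule summable_on_comparison_test[OF c(1) le]) (use w0 in auto)
  have "(\<Sum>\<^sub>\<infinity>\<gamma>\<in>?G. norm (c \<gamma>) * weight N t \<gamma>) \<le> M"
    using infsum_mono[OF s c(1) le] c(2) by (rule order_trans)
  then show ?thesis unfolding expansion_on_def using s c(3) assms(1,2) by (intro exI[of _ c]) force
qed

lemma abs_analytic_on_imp_real_analytic:
  assumes "abs_analytic_on N U f"
  shows "real_analytic_fun_on N U f"
  unfolding real_analytic_fun_on_def
proof
  fix a assume "a \<in> U"
  with assms obtain \<rho> M where \<rho>: "\<rho> > 0" and e: "expansion_on N U a \<rho> M f"
    unfolding abs_analytic_on_def by blast
  from e obtain c where c: "\<And>z. z \<in> U \<Longrightarrow> (\<forall>i\<in>{1..N}. norm (z i - a i) < \<rho>) \<Longrightarrow>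
      ((\<lambda>\<gamma>. c \<gamma> * centred N a z \<gamma>) has_sum f z) (bi_indices N)"
    unfolding expansion_on_def by blast
  show "\<exists>r>0. \<exists>c. \<forall>z\<in>U. (\<forall>i\<in>{1..N}. norm (z i - a i) < r) \<longrightarrow>
        ((\<lambda>(\<alpha>, \<beta>). c \<alpha> \<beta> *
            (\<Prod>i=1..N. of_real (Re (z i - a i)) ^ \<alpha> i * of_real (Im (z i - a i)) ^ \<beta> i))
          has_sum f z) (bi_indices N)"
    using c unfolding centred_def monom2_def
    by (intro exI[of _ \<rho>] exI[of _ "curry c"] conjI \<rho>) (simp add: case_prod_unfold)
qed

lemma abs_analytic_on_cong:
  assumes "abs_analytic_on N U f" "\<And>z. z \<in> U \<Longrightarrow> f z = g z"
  shows "abs_analytic_on N U g"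
  using assms unfolding abs_analytic_on_def expansion_on_def by simp

lemma expansion_on_const: "\<rho> > 0 \<Longrightarrow> expansion_on N U a \<rho> (norm k) (\<lambda>_. k)"
  by (rule expansion_on_regroup[where I = "{()}" and mi = "\<lambda>_. (\<lambda>i\<in>{1..N}. 0, \<lambda>i\<in>{1..N}. 0)" and d = "\<lambda>_. k" and S = "norm k"])
    (auto simp: has_sum_finite_iff monom2_def centred_def multi_indices_def)

lemma abs_analytic_on_const: "abs_analytic_on N U (\<lambda>_. k)"
  unfolding abs_analytic_on_def using expansion_on_const[of 1] zero_less_one by blast

lemma monom2_unit:
  fixes x y :: "nat \<Rightarrow> 'a::comm_semiring_1"
  assumes "j \<in> {1..N}"
  shows "monom2 N x y (\<lambda>i\<in>{1..N}. if i = j then 1 else 0, \<lambda>i\<in>{1..N}. 0) = x j"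
    and "monom2 N x y (\<lambda>i\<in>{1..N}. 0, \<lambda>i\<in>{1..N}. if i = j then 1 else 0) = y j"
proof -
  have "(\<Prod>i=1..N. w i ^ (if i = j then 1 else 0)) = w j" for w :: "nat \<Rightarrow> 'a"
  proof -
    have "(\<Prod>i=1..N. w i ^ (if i = j then 1 else 0)) = (\<Prod>i=1..N. if i = j then w i else 1)"
      by (rule prod.cong) auto
    then show ?thesis using assms by simp
  qed
  from this[of x] this[of y]
  show "monom2 N x y (\<lambda>i\<in>{1..N}. if i = j then 1 else 0, \<lambda>i\<in>{1..N}. 0) = x j"
    and "monom2 N x y (\<lambda>i\<in>{1..N}. 0, \<lambda>i\<in>{1..N}. if i = j then 1 else 0) = y j"
    unfolding monom2_def by simp_all
qed

lemma expansion_on_diff_coordinate: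
  assumes "j \<in> {1..N}" "\<rho> > 0"
  shows "expansion_on N U a \<rho> \<rho> (\<lambda>z. of_real (Re (z j - a j)))"
    and "expansion_on N U a \<rho> \<rho> (\<lambda>z. of_real (Im (z j - a j)))"
  by (rule expansion_on_regroup[where I = "{()}" and d = "\<lambda>_. 1" and S = \<rho>
        and mi = "\<lambda>_. (\<lambda>i\<in>{1..N}. if i = j then 1 else 0, \<lambda>i\<in>{1..N}. 0)"],
      use assms in \<open>auto simp: has_sum_finite_iff monom2_unit centred_def multi_indices_def simp del: One_nat_def\<close>)
    (rule expansion_on_regroup[where I = "{()}" and d = "\<lambda>_. 1" and S = \<rho>
        and mi = "\<lambda>_. (\<lambda>i\<in>{1..N}. 0, \<lambda>i\<in>{1..N}. if i = j then 1 else 0)"],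
      use assms in \<open>auto simp: has_sum_finite_iff monom2_unit centred_def multi_indices_def simp del: One_nat_def\<close>)

lemma abs_analytic_on_common_radius:
  assumes "abs_analytic_on N U f" "abs_analytic_on N U g" "a \<in> U"
  obtains \<rho> M M' where "\<rho> > 0" "expansion_on N U a \<rho> M f" "expansion_on N U a \<rho> M' g"
proof -
  obtain r M where 1: "r > 0" "expansion_on N U a r M f" using assms unfolding abs_analytic_on_def by blast
  obtain s M' where 2: "s > 0" "expansion_on N U a s M' g" using assms unfolding abs_analytic_on_def by blast
  show ?thesis
  proof (rule that[of "min r s"])
    show "expansion_on N U a (min r s) M f" by (rule expansion_on_smaller[OF _ _ 1(2)]) (use 1 2 in auto)
    show "expansion_on N U a (min r s) M' g" by (rule expansion_on_smaller[OF _ _ 2(2)]) (use 1 2 in auto)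
  qed (use 1 2 in auto)
qed

lemma abs_analytic_on_add:
  assumes "abs_analytic_on N U f" "abs_analytic_on N U g"
  shows "abs_analytic_on N U (\<lambda>z. f z + g z)"
  unfolding abs_analytic_on_def
proof
  fix a assume "a \<in> U"
  with assms obtain \<rho> M M' where "\<rho> > 0" "expansion_on N U a \<rho> M f" "expansion_on N U a \<rho> M' g"
    by (rule abs_analytic_on_common_radius)
  from this(1) expansion_on_add[OF this]
  show "\<exists>\<rho>>0. \<exists>M. expansion_on N U a \<rho> M (\<lambda>z. f z + g z)" by blast
qed

lemma abs_analytic_on_mult:
  assumes "abs_analytic_on N U f" "abs_analytic_on N U g"
  shows "abs_analytic_on N U (\<lambda>z. f z * g z)"
  unfolding abs_analytic_on_def
proof
  fix a assume "a \<in> U"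
  with assms obtain \<rho> M M' where "\<rho> > 0" "expansion_on N U a \<rho> M f" "expansion_on N U a \<rho> M' g"
    by (rule abs_analytic_on_common_radius)
  from this(1) expansion_on_mult[OF this]
  show "\<exists>\<rho>>0. \<exists>M. expansion_on N U a \<rho> M (\<lambda>z. f z * g z)" by blast
qed

lemma abs_analytic_on_coordinate:
  assumes "j \<in> {1..N}"
  shows "abs_analytic_on N U (\<lambda>z. of_real (Re (z j)))" "abs_analytic_on N U (\<lambda>z. of_real (Im (z j)))"
proof -
  have 1: "expansion_on N U a 1 (1 + norm (complex_of_real (Re (a j)))) (\<lambda>z. of_real (Re (z j - a j)) + of_real (Re (a j)))" for a
    using assms by (intro expansion_on_add expansion_on_diff_coordinate expansion_on_const) auto
  have 2: "expansion_on N U a 1 (1 + norm (complex_of_real (Im (a j)))) (\<lambda>z. of_real (Im (z j - a j)) + of_real (Im (a j)))" for a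
    using assms by (intro expansion_on_add expansion_on_diff_coordinate expansion_on_const) auto
  show "abs_analytic_on N U (\<lambda>z. of_real (Re (z j)))" "abs_analytic_on N U (\<lambda>z. of_real (Im (z j)))"
    unfolding abs_analytic_on_def using 1[simplified] 2[simplified] zero_less_one by blast+
qed

lemma abs_analytic_on_id:
  assumes "j \<in> {1..N}"
  shows "abs_analytic_on N U (\<lambda>z. z j)"
  by (rule abs_analytic_on_cong[OF abs_analytic_on_add[OF abs_analytic_on_coordinate(1)[OF assms]
          abs_analytic_on_mult[OF abs_analytic_on_const[of _ _ \<i>] abs_analytic_on_coordinate(2)[OF assms]]]])
    (simp add: complex_eq_iff)

text \<open>
  The monomials are real, so it suffices to conjugate the coefficients.
\<close>

lemma abs_analytic_on_cnj:
  assumes "abs_analytic_on N U f"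
  shows "abs_analytic_on N U (\<lambda>z. cnj (f z))"
  unfolding abs_analytic_on_def
proof
  fix a assume "a \<in> U"
  then obtain \<rho> M where \<rho>: "\<rho> > 0" and "expansion_on N U a \<rho> M f"
    using assms unfolding abs_analytic_on_def by blast
  then obtain c where c: "(\<lambda>\<gamma>. norm (c \<gamma>) * weight N \<rho> \<gamma>) summable_on bi_indices N"
     "(\<Sum>\<^sub>\<infinity>\<gamma>\<in>bi_indices N. norm (c \<gamma>) * weight N \<rho> \<gamma>) \<le> M"
     "\<And>z. z \<in> U \<Longrightarrow> (\<forall>i\<in>{1..N}. norm (z i - a i) < \<rho>) \<Longrightarrow>
        ((\<lambda>\<gamma>. c \<gamma> * centred N a z \<gamma>) has_sum f z) (bi_indices N)"
    unfolding expansion_on_def by blast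
  have r: "cnj (centred N a z \<gamma>) = centred N a z \<gamma>" for z \<gamma>
    by (simp add: centred_def monom2_def)
  have "expansion_on N U a \<rho> M (\<lambda>z. cnj (f z))"
    unfolding expansion_on_def
    by (rule exI[of _ "\<lambda>\<gamma>. cnj (c \<gamma>)"])
      (use c has_sum_cnj_iff[THEN iffD2, OF c(3)] in \<open>simp add: r\<close>)
  with \<rho> show "\<exists>\<rho>>0. \<exists>M. expansion_on N U a \<rho> M (\<lambda>z. cnj (f z))" by blast
qed

text \<open>
  Near \<open>a\<close>, write \<open>f = f a \<cdot> (1 - h)\<close> with \<open>h a = 0\<close>; on a small polydisc the norm of \<open>h\<close> is below
  \<open>1\<close> and the geometric series applies.
\<close>

lemma abs_analytic_on_inverse:
  assumes f: "abs_analytic_on N U f" and nz: "\<And>z. z \<in> U \<Longrightarrow> f z \<noteq> 0"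
  shows "abs_analytic_on N U (\<lambda>z. inverse (f z))"
  unfolding abs_analytic_on_def
proof
  fix a assume a: "a \<in> U"
  define h where "h z = 1 + - inverse (f a) * f z" for z
  have "abs_analytic_on N U h"
    unfolding h_def by (intro abs_analytic_on_add abs_analytic_on_mult abs_analytic_on_const f)
  with a obtain \<rho> M where \<rho>: "\<rho> > 0" and h: "expansion_on N U a \<rho> M h"
    unfolding abs_analytic_on_def by blast
  have h0: "h a = 0" using nz[OF a] by (simp add: h_def)
  have M: "0 \<le> M" using expansion_on_norm_le[OF \<rho> h a] \<rho> h0 by simp
  \<comment> \<open>This radius makes the norm of \<open>h\<close> at most \<open>M / (M + 1)\<close>.\<close>
  define t where "t = \<rho> / (M + 1)"
  have t: "0 < t" "t \<le> \<rho>" "t / \<rho> * M < 1" "0 \<le> t / \<rho> * M"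
  proof -
    have "t / \<rho> = 1 / (M + 1)" using \<rho> by (simp add: t_def)
    then show "0 < t" "t \<le> \<rho>" "t / \<rho> * M < 1" "0 \<le> t / \<rho> * M"
      using \<rho> M unfolding t_def by (auto simp: divide_le_eq mult_le_cancel_left1)
  qed
  have "expansion_on N U a t (1 / (1 - t / \<rho> * M)) (\<lambda>z. 1 / (1 - h z))"
    by (rule expansion_on_geometric[OF t(1) expansion_on_shrink[OF t(1,2) h a h0] _ t(4,3)])
      (use expansion_on_const[OF t(1), of N U a 1] in simp)
  then have "expansion_on N U a t (norm (inverse (f a)) * (1 / (1 - t / \<rho> * M))) (\<lambda>z. inverse (f a) * (1 / (1 - h z)))"
    by (intro expansion_on_mult expansion_on_const t)
  moreover have "inverse (f a) * (1 / (1 - h z)) = inverse (f z)" for z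
    using nz[OF a] by (simp add: h_def field_simps)
  ultimately show "\<exists>\<rho>>0. \<exists>M. expansion_on N U a \<rho> M (\<lambda>z. inverse (f z))" using t(1) by auto
qed

lemma inverse_closed_algebra_abs_analytic: "inverse_closed_algebra U (abs_analytic_on N U)"
  by unfold_locales
    (fact abs_analytic_on_const abs_analytic_on_add abs_analytic_on_mult abs_analytic_on_cnj
      abs_analytic_on_inverse abs_analytic_on_cong)+

section \<open>Geometry of the Schur transformation\<close>

lemma closure_of_polydisc: "cspace N closure_of polydisc N = {1..N} \<rightarrow>\<^sub>E cball 0 1"
  unfolding cspace_def polydisc_def closure_of_product_topology by simp

lemma openin_polydisc: "openin (cspace N) (polydisc N)"
  unfolding cspace_def polydisc_def by (subst openin_PiE) auto

lemma frontier_of_polydisc: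
  "cspace N frontier_of polydisc N = ({1..N} \<rightarrow>\<^sub>E cball 0 1) - polydisc N"
  unfolding frontier_of_def closure_of_polydisc interior_of_openin[OF openin_polydisc] ..

lemma polydisc_subset_topspace: "polydisc N \<subseteq> topspace (cspace N)"
  using openin_polydisc by (rule openin_subset)

lemma polydisc_subset_closed: "polydisc N \<subseteq> {1..N} \<rightarrow>\<^sub>E cball 0 1"
  unfolding polydisc_def by (rule PiE_mono) auto

lemma schur_transformation_in_topspace: "schur_transformation N z \<in> topspace (cspace N)"
  by (simp add: schur_transformation_def topspace_cspace)

lemma continuous_schur_transformation: "continuous_map (cspace N) (cspace N) (schur_transformation N)"
proof (rule continuous_map_into_cspace)
  interpret inverse_closed_algebra "topspace (cspace N)" "continuous_map (cspace N) euclidean"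
    by (rule inverse_closed_algebra_continuous_map)
  fix j assume "j \<in> {1..N}"
  then show "continuous_map (cspace N) euclidean (\<lambda>z. schur_transformation N z j)"
    unfolding schur_transformation_def by (auto intro!: schur_fun continuous_map_coordinate)
qed (auto simp: schur_transformation_in_topspace)

text \<open>
  The tuples on which the first \<open>k\<close> parameters are defined and lie in the open disc.
\<close>

definition schur_region :: "nat \<Rightarrow> nat \<Rightarrow> (nat \<Rightarrow> complex) set" where
  "schur_region N k = {c \<in> topspace (cspace N). \<forall>j<k. norm ((peel ^^ j) c 1) < 1}"

text \<open>
  Each parameter is continuous where the preceding ones stay inside the disc, so that the regions
  are open one after the other.
\<close>

lemma openin_schur_region: "k \<le> N \<Longrightarrow> openin (cspace N) (schur_region N k)"
proof (induction k)
  case 0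
  have "schur_region N 0 = topspace (cspace N)" by (auto simp: schur_region_def)
  then show ?case by simp
next
  case (Suc k)
  let ?X = "subtopology (cspace N) (schur_region N k)"
  have op: "openin (cspace N) (schur_region N k)" using Suc by simp
  have top: "topspace ?X = schur_region N k" by (auto simp: schur_region_def)
  interpret inverse_closed_algebra "topspace ?X" "continuous_map ?X euclidean"
    by (rule inverse_closed_algebra_continuous_map)
  have "continuous_map ?X euclidean (\<lambda>c. (peel ^^ k) c 1)"
  proof (rule funpow_peel)
    show "continuous_map ?X euclidean (\<lambda>c. c i)" if "i \<in> {1..N}" for i
      using that by (intro continuous_map_from_subtopology continuous_map_coordinate)
    show "norm ((peel ^^ j) c 1) \<noteq> 1" if "c \<in> topspace ?X" "j < k" for c j
      using that unfolding top schur_region_def by force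
  qed (use Suc.prems in auto)
  then have "openin ?X {c \<in> topspace ?X. (peel ^^ k) c 1 \<in> ball 0 1}"
    by (rule openin_continuous_map_preimage) (simp flip: open_openin)
  also have "{c \<in> topspace ?X. (peel ^^ k) c 1 \<in> ball 0 1} = schur_region N (Suc k)"
    unfolding top by (auto simp: schur_region_def less_Suc_eq)
  finally show ?case using openin_trans_full[OF _ op] by blast
qed

lemma parameters_of_schur_transformation:
  assumes "z \<in> polydisc N" "i \<in> {1..N}"
  shows "(peel ^^ (i - 1)) (schur_transformation N z) 1 = z i"
proof -
  have "norm (z j) < 1" if "j \<in> {1..N}" for j
    using assms(1) that by (auto simp: polydisc_def PiE_iff)
  then have "(peel ^^ (i - 1)) (schur_transformation N z) 1 = z (Suc (i - 1))"
    by (intro schur_parameters_recovered[where N = N]) (use assms(2) in \<open>fastforce simp: schur_transformation_def\<close>)+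
  then show ?thesis using assms(2) by simp
qed

lemma schur_image_polydisc: "schur_transformation N ` polydisc N = schur_region N N"
proof (intro set_eqI iffI)
  fix c assume "c \<in> schur_transformation N ` polydisc N"
  then obtain z where z: "z \<in> polydisc N" "c = schur_transformation N z" by blast
  have "norm ((peel ^^ j) c 1) < 1" if "j < N" for j
    using parameters_of_schur_transformation[OF z(1), of "Suc j"] that z by (auto simp: polydisc_def PiE_iff)
  then show "c \<in> schur_region N N"
    using z(2) schur_transformation_in_topspace by (simp add: schur_region_def)
next
  fix c assume c: "c \<in> schur_region N N"
  define z where "z = (\<lambda>i\<in>{1..N}. (peel ^^ (i - 1)) c 1)"
  have "schur_fun m z = c m" if "m \<in> {1..N}" for m
  proof -
    have "schur_fun m z = schur_fun m (\<lambda>i. (peel ^^ (i - 1)) c 1)"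
      by (rule schur_fun_cong) (use that in \<open>auto simp: z_def\<close>)
    also have "\<dots> = c m" by (rule schur_fun_of_parameters[where N = N]) (use c that in \<open>auto simp: schur_region_def\<close>)
    finally show ?thesis .
  qed
  then have "schur_transformation N z = c"
    using c by (auto simp: schur_region_def topspace_cspace schur_transformation_def fun_eq_iff PiE_def extensional_def)
  moreover have "norm ((peel ^^ (i - 1)) c 1) < 1" if "i \<in> {1..N}" for i
  proof -
    have "i - 1 < N" using that by auto
    then show ?thesis using c unfolding schur_region_def by blast
  qed
  then have "z \<in> polydisc N" by (auto simp: z_def polydisc_def)
  ultimately show "c \<in> schur_transformation N ` polydisc N" by blast
qed

lemma schur_transformation_inj:
  assumes z: "z \<in> polydisc N" and y: "y \<in> topspace (cspace N)"
    and eq: "schur_transformation N z = schur_transformation N y"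
  shows "z = y"
proof -
  have eq': "schur_fun m z = schur_fun m y" if "m \<in> {1..N}" for m
    using fun_cong[OF eq, of m] that by (simp add: schur_transformation_def)
  have z1: "norm (z j) < 1" if "j \<in> {1..N}" for j
    using z that by (auto simp: polydisc_def PiE_iff)
  have "z i = y i" if i: "i \<in> {1..N}" for i
    by (rule schur_fun_injective[OF eq' _ i]) (use z1 i in fastforce)+
  moreover have "z i = y i" if "i \<notin> {1..N}" for i
    using that z y by (simp add: polydisc_def topspace_cspace PiE_def extensional_def)
  ultimately show ?thesis by blast
qed

text \<open>
  One inclusion is the openness of the image of the polydisc. For the other one, a boundary
  point of the polydisc is pushed outwards in its first unimodular coordinate \<open>i\<close>. If the image
  stayed in the coefficient body, it would also be the image of a point \<open>y\<close> of the closed polydisc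
  with the same coordinate \<open>i\<close>, whose modulus exceeds \<open>1\<close>.
\<close>

lemma interior_coefficient_body:
  "cspace N interior_of coefficient_body N = schur_transformation N ` polydisc N"
proof
  have "openin (cspace N) (schur_transformation N ` polydisc N)"
    unfolding schur_image_polydisc by (rule openin_schur_region) simp
  then show "schur_transformation N ` polydisc N \<subseteq> cspace N interior_of coefficient_body N"
    unfolding coefficient_body_eq by (intro interior_of_maximal image_mono polydisc_subset_closed)
next
  let ?I = "cspace N interior_of coefficient_body N"
  show "?I \<subseteq> schur_transformation N ` polydisc N"
  proof
    fix c assume c: "c \<in> ?I"
    then have "c \<in> coefficient_body N" using interior_of_subset by (metis subsetD)
    then obtain z where z: "z \<in> {1..N} \<rightarrow>\<^sub>E cball 0 1" "c = schur_transformation N z"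
      unfolding coefficient_body_eq by blast
    have "z \<in> polydisc N"
    proof (rule ccontr)
      assume "z \<notin> polydisc N"
      then have "\<exists>i. i \<in> {1..N} \<and> norm (z i) = 1"
        using z(1) unfolding polydisc_def by (force simp: PiE_iff)
      then obtain i where i: "i \<in> {1..N}" "norm (z i) = 1"
        and least: "\<And>j. j < i \<Longrightarrow> j \<in> {1..N} \<Longrightarrow> norm (z j) \<noteq> 1"
        using exists_least_iff[of "\<lambda>i. i \<in> {1..N} \<and> norm (z i) = 1"] by blast
      \<comment> \<open>A path through \<open>z\<close> that leaves the closed polydisc for \<open>t > 0\<close>.\<close>
      define p where "p t = z(i := of_real (1 + t) * z i)" for t :: real
      have ptop: "p t \<in> topspace (cspace N)" for t
        using z(1) i by (auto simp: p_def topspace_cspace PiE_def extensional_def)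
      have "continuous_map euclideanreal (cspace N) p"
      proof (rule continuous_map_into_cspace)
        fix j assume "j \<in> {1..N}"
        show "continuous_map euclideanreal euclidean (\<lambda>t. p t j)"
          unfolding p_def by (cases "j = i") (auto intro!: continuous_intros)
      qed (use ptop in auto)
      then have "continuous_map euclideanreal (cspace N) (schur_transformation N \<circ> p)"
        using continuous_schur_transformation by (rule continuous_map_compose)
      from openin_continuous_map_preimage[OF this openin_interior_of]
      have "open {t. schur_transformation N (p t) \<in> ?I}" by simp
      moreover have "0 \<in> {t. schur_transformation N (p t) \<in> ?I}" using c z(2) by (simp add: p_def)
      ultimately obtain e where e: "e > 0" "ball 0 e \<subseteq> {t. schur_transformation N (p t) \<in> ?I}"
        by (meson openE)
      define t where "t = e / 2"
      have t: "t > 0" "t \<in> ball 0 e" using e by (auto simp: t_def)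
      with e have "schur_transformation N (p t) \<in> ?I" by blast
      then have "schur_transformation N (p t) \<in> coefficient_body N" using interior_of_subset by (metis subsetD)
      then obtain y where y: "y \<in> {1..N} \<rightarrow>\<^sub>E cball 0 1" "schur_transformation N (p t) = schur_transformation N y"
        unfolding coefficient_body_eq by blast
      have "schur_fun m (p t) = schur_fun m y" if "m \<in> {1..N}" for m
        using fun_cong[OF y(2), of m] that by (simp add: schur_transformation_def)
      then have "p t i = y i"
        by (rule schur_fun_injective[OF _ _ i(1)]) (use least i in \<open>auto simp: p_def\<close>)
      moreover have "norm (y i) \<le> 1" using y(1) i(1) by (auto simp: PiE_iff)
      moreover have "norm (p t i) = 1 + t" using t i(2) by (simp add: p_def norm_mult del: of_real_add)
      ultimately show False using t by simp
    qed
    then show "c \<in> schur_transformation N ` polydisc N" using z(2) by blast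
  qed
qed

lemma closedin_coefficient_body: "closedin (cspace N) (coefficient_body N)"
proof (rule compactin_imp_closedin)
  show "Hausdorff_space (cspace N)"
    unfolding cspace_def Hausdorff_space_product_topology by simp
  have "compactin (cspace N) ({1..N} \<rightarrow>\<^sub>E cball 0 1)"
    unfolding cspace_def compactin_PiE by auto
  then show "compactin (cspace N) (coefficient_body N)"
    unfolding coefficient_body_eq using continuous_schur_transformation by (rule image_compactin)
qed

text \<open>
  The body is closed, and no point outside the open polydisc shares its image with a point inside.
\<close>

lemma frontier_coefficient_body:
  "cspace N frontier_of coefficient_body N = schur_transformation N ` (cspace N frontier_of polydisc N)"
proof -
  let ?C = "{1..N} \<rightarrow>\<^sub>E cball (0::complex) 1"
  have "?C \<subseteq> topspace (cspace N)" by (auto simp: topspace_cspace)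
  then have "schur_transformation N ` (?C - polydisc N) = schur_transformation N ` ?C - schur_transformation N ` polydisc N"
    using schur_transformation_inj[of _ N] by blast
  then show ?thesis
    unfolding frontier_of_def[of _ "coefficient_body N"] interior_coefficient_body
      closure_of_closedin[OF closedin_coefficient_body] frontier_of_polydisc
    unfolding coefficient_body_eq by (rule sym)
qed

text \<open>
  Tuples that start with \<open>1\<close> are all mapped to the image of the rotation by \<open>1\<close>; as soon as there is a
  second coordinate, there is more than one of them.
\<close>

lemma schur_transformation_not_inj_on_frontier:
  assumes "N \<ge> 2"
  shows "\<exists>z y. z \<in> cspace N frontier_of polydisc N \<and> y \<in> cspace N frontier_of polydisc N \<and> z \<noteq> y \<and>
    schur_transformation N z = schur_transformation N y"
proof -
  define z where "z a = (\<lambda>i\<in>{1..N}. if i = 1 then 1 else a)" for a :: complex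
  have z1: "z a 1 = 1" for a using assms by (simp add: z_def)
  have "z a \<in> cspace N frontier_of polydisc N" if "norm a \<le> 1" for a
    using that assms z1[of a] unfolding frontier_of_polydisc
    unfolding polydisc_def by (auto simp: z_def PiE_iff)
  then have "z 0 \<in> cspace N frontier_of polydisc N" "z 1 \<in> cspace N frontier_of polydisc N" by auto
  moreover have "z 0 2 \<noteq> z 1 2"
    using assms by (simp add: z_def)
  then have "z 0 \<noteq> z 1" by auto
  moreover have "schur_fun m (z 0) = schur_fun m (z 1)" if "m \<ge> 1" for m
    using that z1 schur_fun_unimodular_head[of "z 0" m] schur_fun_unimodular_head[of "z 1" m]
    by (cases "m = 1") (auto simp: schur_fun_1)
  then have "schur_transformation N (z 0) = schur_transformation N (z 1)"
    by (auto simp: schur_transformation_def fun_eq_iff)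
  ultimately show ?thesis by blast
qed

text \<open>
  Both directions are explicit: the map is polynomial in the coordinates and their conjugates,
  and its inverse first applies \<open>L\<close> and then reads off the parameters by Schur's algorithm.
\<close>

lemma real_analytic_diffeomorphism_schur:
  assumes K: "polynomial_transformation N K" and L: "polynomial_transformation N L"
    and LK: "\<And>z. z \<in> topspace (cspace N) \<Longrightarrow> L (K z) = z"
    and op: "openin (cspace N) (K ` schur_transformation N ` polydisc N)"
  shows "real_analytic_diffeomorphism N (polydisc N) ((\<lambda>z. K (schur_transformation N z)) ` polydisc N)
    (\<lambda>z. K (schur_transformation N z))"
proof -
  let ?\<Phi> = "\<lambda>z. K (schur_transformation N z)"
  let ?V = "?\<Phi> ` polydisc N"
  have inv: "(peel ^^ (i - 1)) (L (?\<Phi> z)) 1 = z i" if "z \<in> polydisc N" "i \<in> {1..N}" for z i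
    using parameters_of_schur_transformation[OF that] LK[OF schur_transformation_in_topspace] by simp
  have inj: "inj_on ?\<Phi> (polydisc N)"
  proof (rule inj_onI)
    fix z y assume "z \<in> polydisc N" "y \<in> polydisc N" "?\<Phi> z = ?\<Phi> y"
    moreover from this have "schur_transformation N z = schur_transformation N y"
      using LK[OF schur_transformation_in_topspace] by metis
    ultimately show "z = y" using schur_transformation_inj polydisc_subset_topspace by blast
  qed
  have Vtop: "?V \<subseteq> topspace (cspace N)"
    using openin_subset[OF op] by (simp add: image_image)
  have "real_analytic_fun_on N (polydisc N) (\<lambda>z. ?\<Phi> z j)" if j: "j \<in> {1..N}" for j
  proof (rule abs_analytic_on_imp_real_analytic)
    interpret inverse_closed_algebra "polydisc N" "abs_analytic_on N (polydisc N)"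
      by (rule inverse_closed_algebra_abs_analytic)
    show "abs_analytic_on N (polydisc N) (\<lambda>z. ?\<Phi> z j)"
    proof (rule polynomial[where p = "\<lambda>z. K z j"])
      show "polynomial_fun N (\<lambda>z. K z j)" using K j by (simp add: polynomial_transformation_def)
      show "abs_analytic_on N (polydisc N) (\<lambda>z. schur_transformation N z i)" if "i \<in> {1..N}" for i
        using that unfolding schur_transformation_def by (auto intro!: schur_fun abs_analytic_on_id)
    qed (rule schur_transformation_in_topspace)
  qed
  moreover have "real_analytic_fun_on N ?V (\<lambda>w. inv_into (polydisc N) ?\<Phi> w i)" if i: "i \<in> {1..N}" for i
  proof (rule abs_analytic_on_imp_real_analytic)
    interpret inverse_closed_algebra ?V "abs_analytic_on N ?V"
      by (rule inverse_closed_algebra_abs_analytic)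
    have Lj: "abs_analytic_on N ?V (\<lambda>w. L w j)" if j: "j \<in> {1..N}" for j
    proof (rule polynomial[where p = "\<lambda>z. L z j" and z = "\<lambda>w. w"])
      show "polynomial_fun N (\<lambda>z. L z j)" using L j by (simp add: polynomial_transformation_def)
    qed (use Vtop abs_analytic_on_id in auto)
    have "abs_analytic_on N ?V (\<lambda>w. (peel ^^ (i - 1)) (L w) 1)"
    proof (rule funpow_peel[where N = N])
      fix w j assume w: "w \<in> ?V" and j: "j < i - 1"
      then obtain z where z: "z \<in> polydisc N" "w = ?\<Phi> z" by blast
      have Sj: "Suc j \<in> {1..N}" using j i by auto
      with z(1) have "norm (z (Suc j)) < 1" unfolding polydisc_def PiE_iff by simp
      then show "norm ((peel ^^ j) (L w) 1) \<noteq> 1"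
        using inv[OF z(1) Sj] z(2) by simp
    qed (use i Lj in auto)
    then show "abs_analytic_on N ?V (\<lambda>w. inv_into (polydisc N) ?\<Phi> w i)"
    proof (rule cong)
      fix w assume "w \<in> ?V"
      then obtain z where z: "z \<in> polydisc N" "w = ?\<Phi> z" by blast
      then show "(peel ^^ (i - 1)) (L w) 1 = inv_into (polydisc N) ?\<Phi> w i"
        using inv[OF z(1) i] inv_into_f_f[OF inj z(1)] by simp
    qed
  qed
  ultimately show ?thesis
    unfolding real_analytic_diffeomorphism_def real_analytic_map_on_def
    using openin_polydisc op inj by (auto simp: bij_betw_def image_image)
qed

section \<open>Coefficients of the inverse functions\<close>

lemma eventually_power_neq_0: "eventually (\<lambda>z::complex. z ^ n \<noteq> 0) (at 0)"
  unfolding eventually_at_filter by (rule always_eventually) simp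

lemma smallo_taylor:
  fixes f :: "complex \<Rightarrow> complex"
  assumes f: "f has_fps_expansion F"
  shows "(\<lambda>z. f z - (\<Sum>k=0..n. F $ k * z ^ k)) \<in> o[at 0](\<lambda>z. z ^ n)"
proof -
  define H where "H = F - (\<Sum>k=0..n. fps_const (F $ k) * fps_X ^ k)"
  define h where "h z = f z - (\<Sum>k=0..n. F $ k * z ^ k)" for z
  have h: "h has_fps_expansion H"
    unfolding h_def H_def by (intro fps_expansion_intros f)
  have Hk: "H $ k = 0" if "k \<le> n" for k
    using that by (simp add: H_def fps_sum_nth fps_X_power_nth if_distrib cong: if_cong)
  have "((\<lambda>z. h z / z ^ n) \<longlongrightarrow> 0) (at 0)"
  proof (cases "H = 0")
    case True
    then have "eventually (\<lambda>z. h z = 0) (at 0)"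
      using h has_fps_expansion_0_iff[of h] by (auto simp: eventually_at_filter elim: eventually_mono)
    then show ?thesis by (rule tendsto_eventually[OF eventually_mono]) simp
  next
    case False
    then have sub: "n \<le> subdegree H" by (intro subdegree_geI) (use Hk in auto)
    from has_fps_expansion_shift[OF h sub refl]
    have "((\<lambda>x. if x = 0 then H $ n else h x / x ^ n) \<longlongrightarrow> fps_shift n H $ 0) (nhds 0)"
      by (rule has_fps_expansion_imp_tendsto_0)
    then have "((\<lambda>x. if x = 0 then H $ n else h x / x ^ n) \<longlongrightarrow> 0) (at 0)"
      using Hk by (simp add: tendsto_nhds_iff)
    then show ?thesis
      by (rule Lim_transform_eventually) (auto simp: eventually_at_filter)
  qed
  then have "h \<in> o[at 0](\<lambda>z. z ^ n)"
    by (intro smalloI_tendsto eventually_power_neq_0)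
  then show ?thesis by (simp add: h_def[abs_def])
qed

text \<open>
  The constant coefficient is the limit at \<open>0\<close>; once it is known to vanish, one power of the
  variable cancels.
\<close>

lemma polynomial_smallo_imp_0:
  fixes b :: "nat \<Rightarrow> complex"
  assumes "(\<lambda>z. \<Sum>k=0..n. b k * z ^ k) \<in> o[at 0](\<lambda>z. z ^ n)" "k \<le> n"
  shows "b k = 0"
  using assms
proof (induction n arbitrary: b k)
  case 0
  have "(\<lambda>z. b 0) \<in> o[at (0::complex)](\<lambda>z. 1)" using 0 by simp
  from smalloD_tendsto[OF this] have "((\<lambda>_. b 0) \<longlongrightarrow> 0) (at (0::complex))" by simp
  then show ?case using 0 by (simp add: tendsto_const_iff)
next
  case (Suc n)
  let ?p = "\<lambda>z::complex. \<Sum>k=0..Suc n. b k * z ^ k"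
  have lim: "((\<lambda>z. ?p z / z ^ Suc n) \<longlongrightarrow> 0) (at 0)"
    by (rule smalloD_tendsto[OF Suc.prems(1)])
  have "((\<lambda>z::complex. z ^ Suc n) \<longlongrightarrow> 0 ^ Suc n) (at 0)" by (intro tendsto_intros)
  from tendsto_mult[OF lim this] have "((\<lambda>z. ?p z / z ^ Suc n * z ^ Suc n) \<longlongrightarrow> 0) (at 0)" by simp
  then have "(?p \<longlongrightarrow> 0) (at 0)"
    by (rule Lim_transform_eventually) (auto simp: eventually_at_filter)
  moreover have "(?p \<longlongrightarrow> ?p 0) (at 0)" by (intro tendsto_intros)
  ultimately have "?p 0 = 0" by (intro tendsto_unique[of "at 0" ?p]) auto
  then have b0: "b 0 = 0" by (simp add: sum.atLeast_Suc_atMost power_0_left)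
  have p: "?p z = z * (\<Sum>k=0..n. b (Suc k) * z ^ k)" for z
    unfolding sum.atLeast0_atMost_Suc_shift using b0 by (simp add: sum_distrib_left mult_ac)
  have "((\<lambda>z. (\<Sum>k=0..n. b (Suc k) * z ^ k) / z ^ n) \<longlongrightarrow> 0) (at 0)"
    using lim unfolding p by (rule Lim_transform_eventually) (auto simp: eventually_at_filter)
  then have "(\<lambda>z. \<Sum>k=0..n. b (Suc k) * z ^ k) \<in> o[at 0](\<lambda>z. z ^ n)"
    by (intro smalloI_tendsto eventually_power_neq_0)
  from Suc.IH[OF this] b0 Suc.prems(2) show ?case by (cases k) auto
qed

text \<open>
  This connects the coefficient sets, which are defined by an asymptotic expansion, with power series.
\<close>

lemma taylor_coeffs_unique:
  fixes f :: "complex \<Rightarrow> complex"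
  assumes f: "f has_fps_expansion F" and a: "(\<lambda>z. f z - (\<Sum>k=0..n. a k * z ^ k)) \<in> o[at 0](\<lambda>z. z ^ n)"
    and k: "k \<le> n"
  shows "a k = F $ k"
proof -
  have "(\<lambda>z. (f z - (\<Sum>k=0..n. F $ k * z ^ k)) - (f z - (\<Sum>k=0..n. a k * z ^ k))) \<in> o[at 0](\<lambda>z. z ^ n)"
    by (intro sum_in_smallo smallo_taylor[OF f] a)
  also have "(\<lambda>z. (f z - (\<Sum>k=0..n. F $ k * z ^ k)) - (f z - (\<Sum>k=0..n. a k * z ^ k)))
     = (\<lambda>z. \<Sum>k=0..n. (a k - F $ k) * z ^ k)"
    by (simp add: fun_eq_iff sum_subtractf left_diff_distrib)
  finally show ?thesis using polynomial_smallo_imp_0[OF _ k] by fastforce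
qed

lemma A_class_expansion:
  assumes \<phi>: "\<phi> holomorphic_on ball 0 1" and \<psi>: "\<psi> holomorphic_on ball 0 1" and \<omega>: "\<omega> \<in> Omega"
    and F: "F holomorphic_on ball 0 1" "\<And>z. z \<in> ball 0 1 \<Longrightarrow> F z = \<phi> z * \<psi> (\<omega> z)"
  shows "F has_fps_expansion fps_expansion \<phi> 0 * (fps_expansion \<psi> 0 oo fps_expansion \<omega> 0)"
proof -
  have "(\<lambda>z. \<phi> z * (\<psi> \<circ> \<omega>) z) has_fps_expansion fps_expansion \<phi> 0 * (fps_expansion \<psi> 0 oo fps_expansion \<omega> 0)"
    by (intro has_fps_expansion_mult has_fps_expansion_compose holomorphic_has_fps_expansion[of _ 1])
      (use \<phi> \<psi> \<omega> in \<open>auto simp: Omega_def fps_expansion_nth_0\<close>)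
  moreover have "eventually (\<lambda>z. F z = \<phi> z * (\<psi> \<circ> \<omega>) z) (nhds 0)"
    using F(2) by (intro eventually_nhds_in_open[of "ball 0 1", THEN eventually_mono]) auto
  ultimately show ?thesis
    using has_fps_expansion_cong[of F "\<lambda>z. \<phi> z * (\<psi> \<circ> \<omega>) z"] by blast
qed

text \<open>
  A function that is a right inverse near \<open>0\<close> has as its expansion a right compositional inverse,
  which coincides with the left one because the linear coefficient is not zero.
\<close>

lemma local_inverse_expansion:
  assumes F: "F has_fps_expansion R" "R $ 0 = 0" "R $ 1 \<noteq> 0"
    and g: "g holomorphic_on ball 0 r" "r > 0" "g 0 = 0" "\<And>w. w \<in> ball 0 r \<Longrightarrow> F (g w) = w"
  shows "g has_fps_expansion fps_inv R"
proof -
  let ?G = "fps_expansion g 0"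
  have G: "g has_fps_expansion ?G" by (rule holomorphic_has_fps_expansion[OF g(1,2)])
  have G0: "?G $ 0 = 0" using g(3) by (simp add: fps_expansion_nth_0)
  have RG: "R oo ?G = fps_X"
    by (rule eventually_eq_imp_fps_eq[OF has_fps_expansion_compose[OF F(1) G G0] has_fps_expansion_fps_X g(2)])
      (use g(4) in auto)
  have "?G = (fps_inv R oo R) oo ?G"
    using fps_inv[OF F(2,3)] G0 by simp
  also have "\<dots> = fps_inv R oo (R oo ?G)"
    by (rule fps_compose_assoc[symmetric, OF G0 F(2)])
  also have "\<dots> = fps_inv R" by (simp add: RG)
  finally show ?thesis using G by simp
qed

lemma local_inverse_exists:
  fixes F :: "complex \<Rightarrow> complex"
  assumes F: "F holomorphic_on ball 0 1" "F 0 = 0" "deriv F 0 \<noteq> 0"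
  obtains g r where "r > 0" "g holomorphic_on ball 0 r" "g 0 = 0"
    "\<And>w. w \<in> ball 0 r \<Longrightarrow> g w \<in> ball 0 1 \<and> F (g w) = w"
proof -
  have 0: "(0::complex) \<in> ball 0 1" by simp
  obtain s where s: "s > 0" "ball (0::complex) s \<subseteq> ball 0 1" "open (F ` ball 0 s)" "inj_on F (ball 0 s)"
    by (rule has_complex_derivative_locally_invertible[OF F(1) 0 open_ball F(3)])
  have hol: "F holomorphic_on ball 0 s" using F(1) s(2) by (rule holomorphic_on_subset)
  obtain g where g: "g holomorphic_on F ` ball 0 s" "\<And>z. z \<in> ball 0 s \<Longrightarrow> g (F z) = z"
    by (rule holomorphic_has_inverse[OF hol open_ball s(4)]) auto
  have "0 \<in> F ` ball 0 s" using F(2) s(1) by (force intro: image_eqI[of _ _ 0])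
  then obtain r where r: "r > 0" "ball 0 r \<subseteq> F ` ball 0 s" using s(3) by (meson openE)
  show ?thesis
  proof (rule that[OF r(1) holomorphic_on_subset[OF g(1) r(2)]])
    show "g 0 = 0" using g(2)[of 0] F(2) s(1) by simp
    fix w :: complex assume "w \<in> ball 0 r"
    with r(2) obtain z where z: "z \<in> ball 0 s" "w = F z" by blast
    then show "g w \<in> ball 0 1 \<and> F (g w) = w" using g(2)[OF z(1)] s(2) by auto
  qed
qed

text \<open>
  The coefficients of \<open>\<omega>\<close> beyond the order \<open>N\<close> do not affect the first \<open>N + 1\<close> coefficients of the
  inverse, so the truncated tuple carries all the information that is needed.
\<close>

lemma inverse_coeffs_truncate:
  assumes P: "P $ 0 = 0" and W: "W $ 0 = 0"
  shows "inverse_coeffs P Q N (\<lambda>j\<in>{1..N}. W $ j) = (\<lambda>j\<in>{1..N}. fps_inv (P * (Q oo W)) $ Suc j)"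
proof -
  have "fps_agree N (tuple_fps N (\<lambda>j\<in>{1..N}. W $ j)) W"
    using W by (auto simp: fps_agree_def tuple_fps_def not_less_eq_eq)
  then have "fps_agree (Suc N) (fps_inv (P * (Q oo tuple_fps N (\<lambda>j\<in>{1..N}. W $ j)))) (fps_inv (P * (Q oo W)))"
    by (intro fps_agree_inv fps_agree_mult_Suc P fps_agree_compose)
  then show ?thesis by (auto simp: inverse_coeffs_def fps_agree_def fun_eq_iff)
qed

theorem X2_B_class_eq:
  assumes \<phi>: "\<phi> holomorphic_on ball 0 1" and \<psi>: "\<psi> holomorphic_on ball 0 1"
    and \<phi>0: "\<phi> 0 = 0" "deriv \<phi> 0 \<noteq> 0" and \<psi>0: "\<psi> 0 \<noteq> 0"
  shows "X2 (Suc N) (B_class \<phi> \<psi>) =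
    inverse_coeffs (fps_expansion \<phi> 0) (fps_expansion \<psi> 0) N ` coefficient_body N"
proof -
  let ?P = "fps_expansion \<phi> 0" and ?Q = "fps_expansion \<psi> 0"
  let ?R = "\<lambda>\<omega>. ?P * (?Q oo fps_expansion \<omega> 0)"
  have P: "?P $ 0 = 0" "?P $ 1 \<noteq> 0" using \<phi>0 by (auto simp: fps_expansion_nth_0 fps_expansion_nth_1)
  have Q: "?Q $ 0 \<noteq> 0" using \<psi>0 by (simp add: fps_expansion_nth_0)
  have R: "?R \<omega> $ 0 = 0" "?R \<omega> $ 1 \<noteq> 0" for \<omega> using P Q by (auto simp: fps_mult_nth)
  have W0: "fps_expansion \<omega> 0 $ 0 = 0" if "\<omega> \<in> Omega" for \<omega>
    using that by (auto simp: Omega_def fps_expansion_nth_0)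
  have K: "inverse_coeffs ?P ?Q N ` coefficient_body N = (\<lambda>\<omega>. \<lambda>j\<in>{1..N}. fps_inv (?R \<omega>) $ Suc j) ` Omega"
    unfolding coefficient_body_def image_image
    by (intro image_cong refl inverse_coeffs_truncate P W0)
  have gexp: "g has_fps_expansion fps_inv (?R \<omega>)" if "\<omega> \<in> Omega" "F holomorphic_on ball 0 1"
    "\<And>z. z \<in> ball 0 1 \<Longrightarrow> F z = \<phi> z * \<psi> (\<omega> z)" "r > 0" "g holomorphic_on ball 0 r" "g 0 = 0"
    "\<And>w. w \<in> ball 0 r \<Longrightarrow> F (g w) = w" for \<omega> F g r
    by (rule local_inverse_expansion[OF A_class_expansion[OF \<phi> \<psi> that(1-3)] R that(5,4,6,7)])
  show ?thesis unfolding K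
  proof (intro set_eqI iffI)
    fix x assume "x \<in> X2 (Suc N) (B_class \<phi> \<psi>)"
    then obtain a g where x: "x = (\<lambda>j\<in>{1..N}. a (Suc j))" and g: "g \<in> B_class \<phi> \<psi>"
      and a: "(\<lambda>z. g z - (\<Sum>k=0..Suc N. a k * z ^ k)) \<in> o[at 0](\<lambda>z. z ^ Suc N)"
      unfolding X2_def by auto
    from g obtain F r where F: "F \<in> A_class \<phi> \<psi>" and r: "r > 0" "g holomorphic_on ball 0 r" "g 0 = 0"
      "\<And>w. w \<in> ball 0 r \<Longrightarrow> F (g w) = w"
      unfolding B_class_def by auto
    from F obtain \<omega> where \<omega>: "\<omega> \<in> Omega" "F holomorphic_on ball 0 1" "\<And>z. z \<in> ball 0 1 \<Longrightarrow> F z = \<phi> z * \<psi> (\<omega> z)"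
      unfolding A_class_def by auto
    have "a (Suc j) = fps_inv (?R \<omega>) $ Suc j" if "j \<in> {1..N}" for j
      by (rule taylor_coeffs_unique[OF gexp[OF \<omega> r] a]) (use that in auto)
    then show "x \<in> (\<lambda>\<omega>. \<lambda>j\<in>{1..N}. fps_inv (?R \<omega>) $ Suc j) ` Omega"
      using \<omega>(1) unfolding x by (intro image_eqI[of _ _ \<omega>]) (auto simp: fun_eq_iff)
  next
    fix x assume "x \<in> (\<lambda>\<omega>. \<lambda>j\<in>{1..N}. fps_inv (?R \<omega>) $ Suc j) ` Omega"
    then obtain \<omega> where \<omega>: "\<omega> \<in> Omega" and x: "x = (\<lambda>j\<in>{1..N}. fps_inv (?R \<omega>) $ Suc j)" by blast
    define F where "F = (\<lambda>z. \<phi> z * (\<psi> \<circ> \<omega>) z)"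
    have hol: "F holomorphic_on ball 0 1"
      unfolding F_def using \<phi> \<psi> \<omega> by (intro holomorphic_intros holomorphic_on_compose_gen[of \<omega> _ \<psi> "ball 0 1"]) (auto simp: Omega_def)
    have FA: "F \<in> A_class \<phi> \<psi>" using hol \<omega> unfolding A_class_def F_def by auto
    have Feq: "F z = \<phi> z * \<psi> (\<omega> z)" for z by (simp add: F_def)
    have "F has_fps_expansion ?R \<omega>" by (rule A_class_expansion[OF \<phi> \<psi> \<omega> hol Feq])
    then have "fps_expansion F 0 = ?R \<omega>" by (rule fps_expansion_eqI)
    then have "deriv F 0 \<noteq> 0" using R(2)[of \<omega>] fps_expansion_nth_1[of F] by simp
    moreover have "F 0 = 0" using \<phi>0 by (simp add: F_def)
    ultimately obtain g r where r: "r > 0" "g holomorphic_on ball 0 r" "g 0 = 0"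
      and g: "\<And>w. w \<in> ball 0 r \<Longrightarrow> g w \<in> ball 0 1 \<and> F (g w) = w"
      using local_inverse_exists[OF hol] by blast
    have "g \<in> B_class \<phi> \<psi>" unfolding B_class_def using FA r g by blast
    moreover have "(\<lambda>z. g z - (\<Sum>k=0..Suc N. fps_inv (?R \<omega>) $ k * z ^ k)) \<in> o[at 0](\<lambda>z. z ^ Suc N)"
      by (rule smallo_taylor[OF gexp[OF \<omega> hol Feq r]]) (use g in auto)
    ultimately show "x \<in> X2 (Suc N) (B_class \<phi> \<psi>)"
      unfolding X2_def x by (auto intro!: exI[of _ "\<lambda>k. fps_inv (?R \<omega>) $ k"] bexI[of _ g])
  qed
qed

section \<open>The parametrization of the coefficient set\<close>

theorem theorem4p2:
  fixes \<phi> \<psi> :: "complex \<Rightarrow> complex" and n :: nat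
  assumes "\<phi> holomorphic_on ball 0 1" and "\<psi> holomorphic_on ball 0 1"
    and "\<phi> 0 = 0" and "deriv \<phi> 0 \<noteq> 0" and "\<psi> 0 \<noteq> 0"
    and "n \<ge> 2"
  shows "\<exists>\<Phi> K.
    polynomial_transformation (n - 1) K \<and>
    (\<forall>z \<in> topspace (cspace (n - 1)). \<Phi> z = K (schur_transformation (n - 1) z)) \<and>
    \<Phi> \<in> polydisc (n - 1) \<rightarrow> X2 n (B_class \<phi> \<psi>) \<and>
    continuous_map
      (subtopology (cspace (n - 1)) (cspace (n - 1) closure_of polydisc (n - 1)))
      (subtopology (cspace (n - 1)) (X2 n (B_class \<phi> \<psi>))) \<Phi> \<and>
    \<Phi> ` (cspace (n - 1) closure_of polydisc (n - 1)) = X2 n (B_class \<phi> \<psi>) \<and>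
    (deriv \<psi> 0 \<noteq> 0 \<longrightarrow>
      polynomial_automorphism (n - 1) K \<and>
      \<Phi> ` polydisc (n - 1) = cspace (n - 1) interior_of X2 n (B_class \<phi> \<psi>) \<and>
      \<Phi> ` (cspace (n - 1) frontier_of polydisc (n - 1))
        = cspace (n - 1) frontier_of X2 n (B_class \<phi> \<psi>) \<and>
      real_analytic_diffeomorphism (n - 1) (polydisc (n - 1)) (\<Phi> ` polydisc (n - 1)) \<Phi> \<and>
      (n \<ge> 3 \<longrightarrow> \<not> inj_on \<Phi> (cspace (n - 1) frontier_of polydisc (n - 1))))"
proof -
  define N where "N = n - 1"
  have n: "n = Suc N" using assms(6) by (simp add: N_def)
  let ?P = "fps_expansion \<phi> 0" and ?Q = "fps_expansion \<psi> 0"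
  define K where "K = inverse_coeffs ?P ?Q N"
  define \<Phi> where "\<Phi> = (\<lambda>z. K (schur_transformation N z))"
  define X where "X = X2 n (B_class \<phi> \<psi>)"
  have P: "?P $ 0 = 0" "?P $ 1 \<noteq> 0" and Q: "?Q $ 0 \<noteq> 0"
    using assms by (auto simp: fps_expansion_nth_0 fps_expansion_nth_1)
  have Kpoly: "polynomial_transformation N K"
    unfolding K_def by (rule inverse_coeffs_polynomial[OF P(1)])
  have X: "X = K ` coefficient_body N"
    unfolding X_def n K_def by (rule X2_B_class_eq) (use assms in auto)
  have onto: "\<Phi> ` (cspace N closure_of polydisc N) = X"
    unfolding X closure_of_polydisc coefficient_body_eq \<Phi>_def by (simp add: image_image)
  have into: "\<Phi> \<in> polydisc N \<rightarrow> X"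
    using onto closure_of_subset[OF polydisc_subset_topspace[of N]] by blast
  have "continuous_map (cspace N) (cspace N) \<Phi>"
    using continuous_map_compose[OF continuous_schur_transformation polynomial_transformation_continuous[OF Kpoly]]
    by (simp add: \<Phi>_def comp_def)
  then have cont: "continuous_map (subtopology (cspace N) (cspace N closure_of polydisc N)) (subtopology (cspace N) X) \<Phi>"
    unfolding continuous_map_in_subtopology using onto by (auto intro: continuous_map_from_subtopology)
  have strict: "polynomial_automorphism N K \<and>
      \<Phi> ` polydisc N = cspace N interior_of X \<and>
      \<Phi> ` (cspace N frontier_of polydisc N) = cspace N frontier_of X \<and>
      real_analytic_diffeomorphism N (polydisc N) (\<Phi> ` polydisc N) \<Phi> \<and>
      (n \<ge> 3 \<longrightarrow> \<not> inj_on \<Phi> (cspace N frontier_of polydisc N))" if \<psi>': "deriv \<psi> 0 \<noteq> 0"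
  proof (intro conjI impI)
    have Q1: "?Q $ 1 \<noteq> 0" using \<psi>' by (simp add: fps_expansion_nth_1)
    show aut: "polynomial_automorphism N K"
      unfolding K_def by (rule inverse_coeffs_automorphism[OF P Q Q1])
    have hom: "homeomorphic_map (cspace N) (cspace N) K"
      by (rule polynomial_automorphism_homeomorphic[OF aut])
    have sub: "coefficient_body N \<subseteq> topspace (cspace N)"
      by (rule closedin_subset[OF closedin_coefficient_body])
    show int: "\<Phi> ` polydisc N = cspace N interior_of X"
      unfolding X homeomorphic_map_interior_of[OF hom sub] interior_coefficient_body \<Phi>_def
      by (simp add: image_image)
    show "\<Phi> ` (cspace N frontier_of polydisc N) = cspace N frontier_of X"
      unfolding X homeomorphic_map_frontier_of[OF hom sub] frontier_coefficient_body \<Phi>_def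
      by (simp add: image_image)
    from aut obtain L where L: "polynomial_transformation N L"
      "\<And>z. z \<in> topspace (cspace N) \<Longrightarrow> L (K z) = z"
      unfolding polynomial_automorphism_def by blast
    have "openin (cspace N) (\<Phi> ` polydisc N)" unfolding int by simp
    then show "real_analytic_diffeomorphism N (polydisc N) (\<Phi> ` polydisc N) \<Phi>"
      unfolding \<Phi>_def
      by (intro real_analytic_diffeomorphism_schur[OF Kpoly L]) (simp_all add: image_image)
    assume "n \<ge> 3"
    then obtain z y where "z \<in> cspace N frontier_of polydisc N" "y \<in> cspace N frontier_of polydisc N" "z \<noteq> y"
      "schur_transformation N z = schur_transformation N y"
      using schur_transformation_not_inj_on_frontier[of N] n by auto
    then show "\<not> inj_on \<Phi> (cspace N frontier_of polydisc N)"
      unfolding inj_on_def \<Phi>_def by metis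
  qed
  show ?thesis
    unfolding N_def[symmetric] X_def[symmetric]
    by (rule exI[of _ \<Phi>], rule exI[of _ K]) (use Kpoly into cont onto strict in \<open>auto simp: \<Phi>_def\<close>)
qed

end
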